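(* Let $m\in\mathbb{N}$ be fixed and, for every $N\ge m$, let $V_{m,N}$ be chosen uniformly (i.e. with respect to the Haar measure) in the Stiefel manifold $\mathbb{V}_{m,N}$. Embed $V_{m,N}$ in $\mathbb{R}^{m\times\infty}$ by padding it with zero columns, and equip $\mathbb{R}^{m\times\infty}$ with the product topology. Let $(\beta_N)$ be a sequence of positive numbers such that $\beta_N\to\infty$ and $\beta_N=o(\sqrt{N})$. Then the sequence $\beta_N V_{m,N}$ satisfies a large deviation principle on $\mathbb{R}^{m\times\infty}$ with speed $\frac{N}{\beta_N^2}$ and good convex rate function $$I:\mathbb{R}^{m\times\infty}\to[0,\infty],\qquad I(A)=\frac12\|A\|_F^2.$$
   Context: For integers $m\le N$, the Stiefel manifold is $\mathbb{V}_{m,N}=\{V\in\mathbb{R}^{m\times N}: VV^\top=\operatorname{Id}_m\}$. Its Haar (uniform) probability measure is the unique probability measure on $\mathbb{V}_{m,N}$ such that, for $V$ distributed according to it, $AVB$ has the same distribution as $V$ for all fixed $A\in\mathcal{O}(m)$, $B\in\mathcal{O}(N)$, where $\mathcal{O}(N)$ is the group of real orthogonal $N\times N$ matrices. $\|A\|_F^2=\sum_{i,j}a_{i,j}^2\in[0,\infty]$ is the squared Frobenius norm. Large deviation principle (LDP): for a topological space $\mathbb{X}$, a function $I:\mathbb{X}\to[0,\infty]$ is a rate function if it is lower semicontinuous, i.e. its sublevel sets $\{x: I(x)\le y\}$ are closed for all $y\ge 0$; it is a good rate function if these sets are moreover compact. A sequence of $\mathbb{X}$-valued random variables $X_N$ satisfies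 an LDP with speed $s_N\to\infty$ and rate function $I$ if $$\liminf_{N\to\infty}\frac{1}{s_N}\log\mathbb{P}(X_N\in O)\ge-\inf_{x\in O}I(x)\ \text{ for all open } O\subseteq\mathbb{X},\qquad \limsup_{N\to\infty}\frac{1}{s_N}\log\mathbb{P}(X_N\in C)\le-\inf_{x\in C}I(x)\ \text{ for all closed } C\subseteq\mathbb{X}.$$ *)

theory Defs
  imports "HOL-Analysis.Analysis" "HOL-Probability.Probability" "HOL-Library.Landau_Symbols"
begin

section \<open>Large deviation principles\<close>

definition ext_ln :: "real \<Rightarrow> ereal" where
  "ext_ln p = (if p = 0 then -\<infinity> else ereal (ln p))"

definition rate_function :: "('x::topological_space \<Rightarrow> ennreal) \<Rightarrow> bool" where
  "rate_function I \<longleftrightarrow> (\<forall>y::real. 0 \<le> y \<longrightarrow> closed {x. I x \<le> ennreal y})"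

definition good_rate_function :: "('x::topological_space \<Rightarrow> ennreal) \<Rightarrow> bool" where
  "good_rate_function I \<longleftrightarrow>
     rate_function I \<and> (\<forall>y::real. 0 \<le> y \<longrightarrow> compact {x. I x \<le> ennreal y})"

text \<open>The random variable \<open>X N\<close> lives on its own probability space \<open>M N\<close>. Only large \<open>N\<close>
  matter, so the sequence may be arbitrary for finitely many \<open>N\<close>. In \<^typ>\<open>ennreal\<close> the infimum
  over the empty set is \<open>\<infinity>\<close>.\<close>

definition satisfies_LDP ::
  "(nat \<Rightarrow> 'w measure) \<Rightarrow> (nat \<Rightarrow> 'w \<Rightarrow> 'x::topological_space) \<Rightarrow> (nat \<Rightarrow> real) \<Rightarrow> ('x \<Rightarrow> ennreal) \<Rightarrow> bool"
where
  "satisfies_LDP M X s I \<longleftrightarrow>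
     (\<forall>\<^sub>F N in sequentially. prob_space (M N) \<and> X N \<in> borel_measurable (M N)) \<and>
     filterlim s at_top sequentially \<and>
     rate_function I \<and>
     (\<forall>U. open U \<longrightarrow>
        - enn2ereal (INF x\<in>U. I x)
          \<le> liminf (\<lambda>N. ereal (1 / s N) * ext_ln (measure (M N) {\<omega> \<in> space (M N). X N \<omega> \<in> U}))) \<and>
     (\<forall>C. closed C \<longrightarrow>
        limsup (\<lambda>N. ereal (1 / s N) * ext_ln (measure (M N) {\<omega> \<in> space (M N). X N \<omega> \<in> C}))
          \<le> - enn2ereal (INF x\<in>C. I x))"

text \<open>Function types are not an instance of \<^class>\<open>real_vector\<close> in the libraries, so convexity is
  spelled out with pointwise convex combinations.\<close>

definition convex_functional :: "(('i \<Rightarrow> real) \<Rightarrow> ennreal) \<Rightarrow> bool" where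
  "convex_functional I \<longleftrightarrow>
     (\<forall>A B. \<forall>u v::real. 0 \<le> u \<longrightarrow> 0 \<le> v \<longrightarrow> u + v = 1 \<longrightarrow>
        I (\<lambda>p. u * A p + v * B p) \<le> ennreal u * I A + ennreal v * I B)"

section \<open>The Stiefel manifold and its Haar measure\<close>

text \<open>The \<open>m\<close> rows are indexed by the finite type \<open>'m\<close>. The \<open>m \<times> N\<close> matrices are the elements of
  \<open>(UNIV \<times> {..<N}) \<rightarrow>\<^sub>E UNIV\<close>, and the \<open>m \<times> \<infinity>\<close> matrices are all of
  \<^typ>\<open>'m \<times> nat \<Rightarrow> real\<close>, whose library topology is the product topology.\<close>

definition stiefel :: "nat \<Rightarrow> ('m::finite \<times> nat \<Rightarrow> real) set" where
  "stiefel N = {V \<in> (UNIV \<times> {..<N}) \<rightarrow>\<^sub>E UNIV.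
     \<forall>i k. (\<Sum>j<N. V (i, j) * V (k, j)) = (if i = k then 1 else 0)}"

definition stiefel_borel :: "nat \<Rightarrow> ('m::finite \<times> nat \<Rightarrow> real) measure" where
  "stiefel_borel N = restrict_space (Pi\<^sub>M (UNIV \<times> {..<N}) (\<lambda>_. borel)) (stiefel N)"

text \<open>The size \<open>N\<close> varies, so \<open>N \<times> N\<close> matrices are represented by functions on pairs of naturals of
  which only the entries with both indices below \<open>N\<close> are relevant.\<close>

definition orthogonal_group :: "nat \<Rightarrow> (nat \<Rightarrow> nat \<Rightarrow> real) set" where
  "orthogonal_group N = {B. \<forall>k<N. \<forall>l<N.
     (\<Sum>j<N. B k j * B l j) = (if k = l then 1 else 0) \<and>
     (\<Sum>j<N. B j k * B j l) = (if k = l then 1 else 0)}"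

text \<open>The product \<open>A V B\<close> of sizes \<open>m \<times> m\<close>, \<open>m \<times> N\<close> and \<open>N \<times> N\<close>.\<close>

definition two_sided_mult ::
  "nat \<Rightarrow> real^'m^'m \<Rightarrow> (nat \<Rightarrow> nat \<Rightarrow> real) \<Rightarrow> ('m::finite \<times> nat \<Rightarrow> real) \<Rightarrow> 'm \<times> nat \<Rightarrow> real"
where
  "two_sided_mult N A B V =
     (\<lambda>(i, j) \<in> UNIV \<times> {..<N}. \<Sum>k\<in>UNIV. \<Sum>l<N. A $ i $ k * V (k, l) * B l j)"

text \<open>The following makes the pushforward in the invariance condition below a genuine measure.\<close>

lemma two_sided_mult_measurable:
  assumes "orthogonal_matrix (A::real^'m::finite^'m)" "B \<in> orthogonal_group N"
  shows "two_sided_mult N A B \<in> stiefel_borel N \<rightarrow>\<^sub>M stiefel_borel N"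
  unfolding stiefel_borel_def
proof (rule measurable_restrict_space2)
  have BB: "(\<Sum>j<N. B k j * B l j) = (if k = l then 1 else 0)" if "k<N" "l<N" for k l
    using assms(2) that by (auto simp: orthogonal_group_def)
  have AA: "(\<Sum>a\<in>UNIV. A$i$a * A$k$a) = (if i = k then 1 else 0)" for i k
  proof -
    have "(A ** transpose A) $ i $ k = mat 1 $ i $ k" using assms(1) by (simp add: orthogonal_matrix_def)
    then show ?thesis by (simp add: matrix_matrix_mult_def transpose_def mat_def)
  qed
  show "two_sided_mult N A B \<in> space (restrict_space (Pi\<^sub>M (UNIV \<times> {..<N}) (\<lambda>_. borel)) (stiefel N)) \<rightarrow> stiefel N"
  proof 
    fix V assume "V \<in> space (restrict_space (Pi\<^sub>M (UNIV \<times> {..<N}) (\<lambda>_. borel)) (stiefel N) :: ('m \<times> nat \<Rightarrow> real) measure)"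
    then have V: "(\<Sum>j<N. V (i, j) * V (k, j)) = (if i = k then 1 else 0)" for i k
      by (auto simp: space_restrict_space stiefel_def)
    have "(\<Sum>j<N. two_sided_mult N A B V (i, j) * two_sided_mult N A B V (k, j)) = (if i = k then 1 else 0)" for i k
    proof -
      have "(\<Sum>j<N. two_sided_mult N A B V (i, j) * two_sided_mult N A B V (k, j))
        = (\<Sum>j<N. \<Sum>a\<in>UNIV. \<Sum>l<N. \<Sum>b\<in>UNIV. \<Sum>n<N. (A $ i $ a * V (a, l) * B l j) * (A $ k $ b * V (b, n) * B n j))"
        by (simp add: two_sided_mult_def, simp only: sum_distrib_right, simp only: sum_distrib_left)
      also have "\<dots> = (\<Sum>a\<in>UNIV. \<Sum>l<N. \<Sum>b\<in>UNIV. \<Sum>n<N. \<Sum>j<N. (A $ i $ a * V (a, l) * B l j) * (A $ k $ b * V (b, n) * B n j))"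
        by (rule trans[OF sum.swap], rule sum.cong[OF refl])+ (rule refl)
      also have "\<dots> = (\<Sum>a\<in>UNIV. \<Sum>l<N. \<Sum>b\<in>UNIV. \<Sum>n<N. A $ i $ a * A $ k $ b * V (a, l) * V (b, n) * (\<Sum>j<N. B l j * B n j))"
        by (simp add: sum_distrib_left mult_ac)
      also have "\<dots> = (\<Sum>a\<in>UNIV. \<Sum>l<N. \<Sum>b\<in>UNIV. A $ i $ a * A $ k $ b * V (a, l) * V (b, l))"
        by (intro sum.cong refl) (simp add: BB if_distrib sum.delta cong: if_cong)
      also have "\<dots> = (\<Sum>a\<in>UNIV. \<Sum>b\<in>UNIV. A $ i $ a * A $ k $ b * (\<Sum>l<N. V (a, l) * V (b, l)))"
        by (rule sum.cong[OF refl], rule trans[OF sum.swap]) (simp add: sum_distrib_left mult_ac)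
      also have "\<dots> = (if i = k then 1 else 0)"
        by (simp add: V AA if_distrib cong: if_cong)
      finally show ?thesis .
    qed
    then show "two_sided_mult N A B V \<in> stiefel N"
      unfolding stiefel_def by (auto simp: two_sided_mult_def)
  qed
  have "two_sided_mult N A B \<in> Pi\<^sub>M (UNIV \<times> {..<N}) (\<lambda>_. borel) \<rightarrow>\<^sub>M Pi\<^sub>M (UNIV \<times> {..<N}) (\<lambda>_. borel)"
    unfolding two_sided_mult_def by (rule measurable_restrict) (auto intro!: borel_measurable_sum borel_measurable_times measurable_component_singleton)
  then show "two_sided_mult N A B \<in> restrict_space (Pi\<^sub>M (UNIV \<times> {..<N}) (\<lambda>_. borel)) (stiefel N) \<rightarrow>\<^sub>M Pi\<^sub>M (UNIV \<times> {..<N}) (\<lambda>_. borel)"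
    by (rule measurable_restrict_space1)
qed

definition stiefel_haar :: "nat \<Rightarrow> ('m::finite \<times> nat \<Rightarrow> real) measure \<Rightarrow> bool" where
  "stiefel_haar N \<mu> \<longleftrightarrow>
     prob_space \<mu> \<and> sets \<mu> = sets (stiefel_borel N) \<and>
     (\<forall>A B. orthogonal_matrix A \<longrightarrow> B \<in> orthogonal_group N \<longrightarrow>
        distr \<mu> (stiefel_borel N) (two_sided_mult N A B) = \<mu>)"

definition pad_columns :: "nat \<Rightarrow> ('m \<times> nat \<Rightarrow> real) \<Rightarrow> 'm \<times> nat \<Rightarrow> real" where
  "pad_columns N V = (\<lambda>(i, j). if j < N then V (i, j) else 0)"

definition frobenius_sq :: "('m::finite \<times> nat \<Rightarrow> real) \<Rightarrow> ennreal" where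
  "frobenius_sq A = (\<Sum>i\<in>UNIV. \<Sum>j. ennreal ((A (i, j))\<^sup>2))"

end

theory Submission
  imports Defs "HOL-Real_Asymp.Real_Asymp"
begin

text \<open>
  The \<open>m \<times> k\<close> upper left corner of a large Haar matrix \<open>V\<close> looks like a Gaussian matrix divided by
  \<open>sqrt N\<close>; scaled by \<open>\<beta>\<close> it has the moderate deviations of \<open>\<beta> / sqrt N\<close> times a standard Gaussian,
  whose rate is half the squared norm. The proof makes this precise without densities and without
  uniqueness of the Haar measure, by coupling \<open>V\<close> with an independent \<open>N \<times> k\<close> matrix \<open>H\<close> of standard
  normal entries and looking at \<open>V H\<close> from two sides.

  For fixed \<open>V\<close> the rows of \<open>V\<close> are orthonormal, so \<open>V H\<close> is an \<open>m \<times> k\<close> standard Gaussian matrix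
  (\<open>gaussian_mgf_project\<close>). Its norm has explicit exponential moments (\<open>gaussian_mgf_exp_square\<close>) and
  its probability of hitting a small box around a far away point is estimated by exponential tilting
  (\<open>gaussian_mgf_box_lower\<close>).

  For fixed \<open>H\<close> the columns of \<open>H / sqrt N\<close> are almost orthonormal, outside an event of probability
  \<open>exp (- c N)\<close> by Cramer's bound (\<open>gram_close_probability\<close>). A rotation \<open>B\<close> obtained from the
  Householder QR decomposition takes them almost to the first \<open>k\<close> unit vectors
  (\<open>near_orthonormal_rotation\<close>), so \<open>V H / sqrt N\<close> is almost the first \<open>k\<close> columns of \<open>V B\<^sup>T\<close>, which is
  distributed like \<open>V\<close> (\<open>gram_close_comparison\<close>). Since \<open>\<beta>\<close> tends to infinity, \<open>exp (- c N)\<close> is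
  negligible at speed \<open>N / \<beta>\<^sup>2\<close>. Fubini's theorem then transfers both Gaussian estimates to the first
  \<open>k\<close> columns of \<open>V\<close> (\<open>stiefel_norm_tail\<close>, \<open>stiefel_box_lower\<close>).

  Finitely many columns suffice. An open set contains a cylinder around each of its points
  (\<open>open_contains_cylinder\<close>), which gives the lower bound. For the upper bound, compactness of the
  sublevel sets of the rate function shows that a closed set on which the rate exceeds \<open>a\<close> is contained
  in the set where the squared norm of the first \<open>k\<close> columns exceeds \<open>2 a\<close>, for some \<open>k\<close>
  (\<open>closed_above_rate_column_bound\<close>).
\<close>

section \<open>Standard Gaussian vectors\<close>

text \<open>Completing the square turns the integrand into a multiple of the normal density with mean
  \<open>c / (1 - a)\<close> and variance \<open>1 / (1 - a)\<close>. The term linear in \<open>x\<close> gives the moment generating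
  function, the quadratic one the exponential moments of a chi-squared variable.\<close>

lemma nn_integral_std_normal_exp_quadratic:
  fixes a c :: real
  assumes "a < 1"
  shows "(\<integral>\<^sup>+ x. ennreal (exp (c * x + a * x\<^sup>2 / 2)) \<partial>std_normal_distribution)
    = ennreal (exp (c\<^sup>2 / (2 * (1 - a))) / sqrt (1 - a))"
proof -
  define s where "s = 1 / sqrt (1 - a)"
  have s: "s > 0" "s\<^sup>2 = 1 / (1 - a)"
    using assms by (auto simp: s_def power_divide)
  have a: "a = 1 - 1 / s\<^sup>2"
    using s assms by (simp add: field_simps)
  have eq: "std_normal_density x * exp (c * x + a * x\<^sup>2 / 2)
      = exp (c\<^sup>2 * s\<^sup>2 / 2) * s * normal_density (c * s\<^sup>2) s x" for x
  proof -
    have "- x\<^sup>2 / 2 + (c * x + a * x\<^sup>2 / 2) = c\<^sup>2 * s\<^sup>2 / 2 + - (x - c * s\<^sup>2)\<^sup>2 / (2 * s\<^sup>2)"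
      unfolding a using s(1) by (simp add: field_simps power2_eq_square)
    then have "exp (- x\<^sup>2 / 2) * exp (c * x + a * x\<^sup>2 / 2)
      = exp (c\<^sup>2 * s\<^sup>2 / 2) * exp (- (x - c * s\<^sup>2)\<^sup>2 / (2 * s\<^sup>2))"
      by (simp flip: exp_add)
    then show ?thesis
      using s(1) by (simp add: std_normal_density_def normal_density_def real_sqrt_mult)
  qed
  have "(\<integral>\<^sup>+ x. ennreal (exp (c * x + a * x\<^sup>2 / 2)) \<partial>std_normal_distribution)
    = (\<integral>\<^sup>+ x. ennreal (std_normal_density x * exp (c * x + a * x\<^sup>2 / 2)) \<partial>lborel)"
    by (subst nn_integral_density) (auto simp: ennreal_mult')
  also have "\<dots> = (\<integral>\<^sup>+ x. ennreal (exp (c\<^sup>2 * s\<^sup>2 / 2) * s) * ennreal (normal_density (c * s\<^sup>2) s x) \<partial>lborel)"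
    unfolding eq using s(1) by (simp add: ennreal_mult')
  also have "\<dots> = ennreal (exp (c\<^sup>2 * s\<^sup>2 / 2) * s) * (\<integral>\<^sup>+ x. ennreal (normal_density (c * s\<^sup>2) s x) \<partial>lborel)"
    by (rule nn_integral_cmult) simp
  also have "(\<integral>\<^sup>+ x. ennreal (normal_density (c * s\<^sup>2) s x) \<partial>lborel) = 1"
    using s(1) by (subst nn_integral_eq_integral) (auto simp: integral_normal_density)
  finally show ?thesis
    using s by (simp add: s_def power_divide)
qed

lemma nn_integral_std_normal_exp_linear:
  "(\<integral>\<^sup>+ x. ennreal (exp (c * x)) \<partial>std_normal_distribution) = ennreal (exp (c\<^sup>2 / 2))"
  using nn_integral_std_normal_exp_quadratic[of 0 c] by simp

lemma nn_integral_PiM_exp_sum: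
  fixes f :: "'i \<Rightarrow> 'a \<Rightarrow> real"
  assumes "\<And>i. prob_space (M i)" "finite I"
    and f: "\<And>i. i \<in> I \<Longrightarrow> f i \<in> borel_measurable (M i)"
    and g: "\<And>i. i \<in> I \<Longrightarrow> (\<integral>\<^sup>+ x. ennreal (exp (f i x)) \<partial>M i) = ennreal (exp (g i))"
  shows "(\<integral>\<^sup>+ \<omega>. ennreal (exp (\<Sum>i\<in>I. f i (\<omega> i))) \<partial>Pi\<^sub>M I M) = ennreal (exp (\<Sum>i\<in>I. g i))"
proof -
  interpret product_prob_space M by (intro product_prob_spaceI assms)
  have "(\<integral>\<^sup>+ \<omega>. ennreal (exp (\<Sum>i\<in>I. f i (\<omega> i))) \<partial>Pi\<^sub>M I M) = (\<integral>\<^sup>+ \<omega>. (\<Prod>i\<in>I. ennreal (exp (f i (\<omega> i)))) \<partial>Pi\<^sub>M I M)"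
    using assms(2) by (simp add: exp_sum prod_ennreal)
  also have "\<dots> = (\<Prod>i\<in>I. \<integral>\<^sup>+ x. ennreal (exp (f i x)) \<partial>M i)"
    using assms(2) f by (intro product_nn_integral_prod) auto
  also have "\<dots> = (\<Prod>i\<in>I. ennreal (exp (g i)))"
    using g by simp
  finally show ?thesis
    using assms(2) by (simp add: exp_sum prod_ennreal)
qed

interpretation gauss: prob_space std_normal_distribution
  by (rule prob_space_normal_density) simp

text \<open>Equivalently, \<open>X\<close> is a standard Gaussian vector indexed by \<open>J\<close>. Taking the moment generating
  function as the definition avoids the uniqueness theorem for multivariate laws and the rotation
  invariance of product measures: the two estimates below only ever integrate exponentials of linear
  forms, and for \<open>V H\<close> the moment generating function is a direct computation.\<close>

definition gaussian_mgf :: "'w measure \<Rightarrow> 'p set \<Rightarrow> ('w \<Rightarrow> 'p \<Rightarrow> real) \<Rightarrow> bool" where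
  "gaussian_mgf P J X \<longleftrightarrow> prob_space P \<and> finite J \<and> (\<forall>p\<in>J. (\<lambda>\<omega>. X \<omega> p) \<in> borel_measurable P) \<and>
     (\<forall>c. (\<integral>\<^sup>+ \<omega>. ennreal (exp (\<Sum>p\<in>J. c p * X \<omega> p)) \<partial>P) = ennreal (exp (\<Sum>p\<in>J. (c p)\<^sup>2 / 2)))"

lemma gaussian_mgf_PiM:
  assumes "finite J"
  shows "gaussian_mgf (Pi\<^sub>M J (\<lambda>_. std_normal_distribution)) J (\<lambda>x. x)"
proof -
  have "prob_space (Pi\<^sub>M J (\<lambda>_. std_normal_distribution))"
    by (intro prob_space_PiM gauss.prob_space_axioms)
  moreover have "(\<integral>\<^sup>+ \<omega>. ennreal (exp (\<Sum>p\<in>J. c p * \<omega> p)) \<partial>Pi\<^sub>M J (\<lambda>_. std_normal_distribution))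
     = ennreal (exp (\<Sum>p\<in>J. (c p)\<^sup>2 / 2))" for c
    using nn_integral_PiM_exp_sum[of "\<lambda>_. std_normal_distribution" J "\<lambda>p x. c p * x" "\<lambda>p. (c p)\<^sup>2 / 2"]
       nn_integral_std_normal_exp_linear assms gauss.prob_space_axioms
    by auto
  ultimately show ?thesis
    using assms unfolding gaussian_mgf_def by auto
qed

text \<open>The square in the exponent is linearised: \<open>exp (a x\<^sup>2 / 2)\<close> is the average of
  \<open>exp (sqrt a x g)\<close> over an auxiliary standard normal \<open>g\<close>. After exchanging the integrals the
  hypothesis applies to \<open>X\<close>, and what remains is the same integral over \<open>g\<close>, where the coordinates
  are independent.\<close>

lemma gaussian_mgf_exp_square:
  assumes X: "gaussian_mgf P J X" and "0 \<le> a" "a < 1"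
  shows "(\<integral>\<^sup>+ \<omega>. ennreal (exp (a / 2 * (\<Sum>p\<in>J. (X \<omega> p)\<^sup>2))) \<partial>P) = ennreal ((1 / sqrt (1 - a)) ^ card J)"
proof -
  let ?G = "Pi\<^sub>M J (\<lambda>_. std_normal_distribution)"
  have J: "finite J" and P: "prob_space P" and m[measurable]: "\<And>p. p \<in> J \<Longrightarrow> (\<lambda>\<omega>. X \<omega> p) \<in> borel_measurable P"
    and mgf: "\<And>c. (\<integral>\<^sup>+ \<omega>. ennreal (exp (\<Sum>p\<in>J. c p * X \<omega> p)) \<partial>P) = ennreal (exp (\<Sum>p\<in>J. (c p)\<^sup>2 / 2))"
    using X by (auto simp: gaussian_mgf_def)
  have G: "gaussian_mgf ?G J (\<lambda>x. x)"
    using J by (rule gaussian_mgf_PiM)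
  then have mgfG: "\<And>c. (\<integral>\<^sup>+ g. ennreal (exp (\<Sum>p\<in>J. c p * g p)) \<partial>?G) = ennreal (exp (\<Sum>p\<in>J. (c p)\<^sup>2 / 2))"
    by (auto simp: gaussian_mgf_def)
  interpret P: prob_space P by fact
  interpret G: prob_space ?G using G by (simp add: gaussian_mgf_def)
  interpret PG: pair_sigma_finite P ?G ..
  let ?e = "\<lambda>\<omega> g. ennreal (exp (\<Sum>p\<in>J. (sqrt a * X \<omega> p) * g p))"
  have meas: "case_prod ?e \<in> borel_measurable (P \<Otimes>\<^sub>M ?G)"
  proof -
    have "(\<lambda>z. snd z p) \<in> borel_measurable (P \<Otimes>\<^sub>M ?G)" if "p \<in> J" for p
      using that by measurable
    moreover have "(\<lambda>z. X (fst z) p) \<in> borel_measurable (P \<Otimes>\<^sub>M ?G)" if "p \<in> J" for p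
      using that by measurable
    ultimately show ?thesis
      unfolding case_prod_beta by (intro measurable_compose[OF _ measurable_ennreal] borel_measurable_exp borel_measurable_sum
         borel_measurable_times measurable_compose[OF _ borel_measurable_exp]) auto
  qed
  have "(\<integral>\<^sup>+ \<omega>. ennreal (exp (a / 2 * (\<Sum>p\<in>J. (X \<omega> p)\<^sup>2))) \<partial>P) = (\<integral>\<^sup>+ \<omega>. \<integral>\<^sup>+ g. ?e \<omega> g \<partial>?G \<partial>P)"
  proof (intro nn_integral_cong)
    fix \<omega>
    have "(\<integral>\<^sup>+ g. ?e \<omega> g \<partial>?G) = ennreal (exp (\<Sum>p\<in>J. (sqrt a * X \<omega> p)\<^sup>2 / 2))"
      by (rule mgfG)
    then show "ennreal (exp (a / 2 * (\<Sum>p\<in>J. (X \<omega> p)\<^sup>2))) = (\<integral>\<^sup>+ g. ?e \<omega> g \<partial>?G)"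
      using assms by (simp add: power_mult_distrib sum_distrib_left)
  qed
  also have "\<dots> = (\<integral>\<^sup>+ g. \<integral>\<^sup>+ \<omega>. ?e \<omega> g \<partial>P \<partial>?G)"
    by (rule PG.Fubini'[OF meas, symmetric])
  also have "\<dots> = (\<integral>\<^sup>+ g. ennreal (exp (\<Sum>p\<in>J. a * (g p)\<^sup>2 / 2)) \<partial>?G)"
  proof (intro nn_integral_cong)
    fix g
    have "(\<integral>\<^sup>+ \<omega>. ?e \<omega> g \<partial>P) = (\<integral>\<^sup>+ \<omega>. ennreal (exp (\<Sum>p\<in>J. (sqrt a * g p) * X \<omega> p)) \<partial>P)"
      by (simp add: mult_ac)
    also have "\<dots> = ennreal (exp (\<Sum>p\<in>J. (sqrt a * g p)\<^sup>2 / 2))"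
      by (rule mgf)
    finally show "(\<integral>\<^sup>+ \<omega>. ?e \<omega> g \<partial>P) = ennreal (exp (\<Sum>p\<in>J. a * (g p)\<^sup>2 / 2))"
      using assms by (simp add: power_mult_distrib)
  qed
  also have "\<dots> = ennreal (exp (\<Sum>p\<in>J. ln (1 / sqrt (1 - a))))"
    using assms J by (intro nn_integral_PiM_exp_sum gauss.prob_space_axioms)
      (auto simp: nn_integral_std_normal_exp_quadratic[of a 0, simplified])
  also have "\<dots> = ennreal ((1 / sqrt (1 - a)) ^ card J)"
    using assms by (simp add: exp_of_nat_mult)
  finally show ?thesis .
qed

text \<open>The two-sided Chernoff bound in pointwise form.\<close>

lemma indicator_abs_ge_le_exp:
  fixes x e s :: real
  assumes "0 \<le> s"
  shows "(if e \<le> \<bar>x\<bar> then 1 else 0) \<le> exp (s * x - s * e) + exp (- s * x - s * e)"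
proof (cases "e \<le> \<bar>x\<bar>")
  case True
  have "1 \<le> exp (s * \<bar>x\<bar> - s * e)"
    using True assms by (simp add: mult_left_mono)
  also have "\<dots> \<le> exp (s * x - s * e) + exp (- s * x - s * e)"
    by (cases "0 \<le> x") auto
  finally show ?thesis
    using True by simp
qed (simp add: add_nonneg_nonneg)

text \<open>Under the exponentially tilted measure with density proportional to \<open>exp (t a \<bullet> X)\<close> the vector
  \<open>X - t a\<close> is again standard Gaussian, so it leaves the box of radius \<open>e t\<close> with probability at most
  \<open>2 card J exp (- (e t)\<^sup>2 / 2)\<close>. Inside the box \<open>exp (t a \<bullet> X)\<close> is at most
  \<open>exp (t\<^sup>2 (\<bar>a\<bar>\<^sup>2 + e \<Sum>\<bar>a p\<bar>))\<close>, which converts the tilted probability into the original one. The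
  proof runs this argument on unnormalised integrals.\<close>

lemma gaussian_mgf_box_lower:
  assumes X: "gaussian_mgf P J X" and "0 < e" "0 \<le> t"
  shows "emeasure P {\<omega>\<in>space P. \<forall>p\<in>J. \<bar>X \<omega> p - t * a p\<bar> < e * t}
     \<ge> ennreal (exp (- t\<^sup>2 * ((\<Sum>p\<in>J. (a p)\<^sup>2) / 2 + e * (\<Sum>p\<in>J. \<bar>a p\<bar>))) * (1 - 2 * card J * exp (- (e * t)\<^sup>2 / 2)))"
proof -
  have J[simp]: "finite J" and P: "prob_space P" and m[measurable]: "\<And>p. p \<in> J \<Longrightarrow> (\<lambda>\<omega>. X \<omega> p) \<in> borel_measurable P"
    and mgf: "\<And>c. (\<integral>\<^sup>+ \<omega>. ennreal (exp (\<Sum>p\<in>J. c p * X \<omega> p)) \<partial>P) = ennreal (exp (\<Sum>p\<in>J. (c p)\<^sup>2 / 2))"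
    using X by (auto simp: gaussian_mgf_def)
  interpret P: prob_space P by fact
  define S where "S = {\<omega>\<in>space P. \<forall>p\<in>J. \<bar>X \<omega> p - t * a p\<bar> < e * t}"
  have S[measurable]: "S \<in> sets P"
    unfolding S_def by measurable
  define n where "n = (\<Sum>p\<in>J. (a p)\<^sup>2)"
  define l where "l = (\<Sum>p\<in>J. \<bar>a p\<bar>)"
  define T where "T \<omega> = exp (\<Sum>p\<in>J. (t * a p) * X \<omega> p)" for \<omega>
  have T[measurable]: "T \<in> borel_measurable P"
    unfolding T_def by measurable
  have T0: "T \<omega> \<ge> 0" for \<omega> by (simp add: T_def)
  \<comment> \<open>the optimal exponent in the Chernoff bound at distance \<open>e * t\<close>\<close>
  define s where "s = e * t"
  have s: "0 \<le> s" using assms by (simp add: s_def)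
  \<comment> \<open>Chernoff bound for coordinate \<open>p\<close> under the tilted measure; \<open>r\<close> is \<open>s\<close> or \<open>- s\<close> for the two sides\<close>
  have shift: "(\<integral>\<^sup>+ \<omega>. ennreal (T \<omega> * exp (r * (X \<omega> p - t * a p) - s * s)) \<partial>P)
     = ennreal (exp (t\<^sup>2 * n / 2) * exp (- s\<^sup>2 / 2))" if p: "p \<in> J" and r: "r\<^sup>2 = s\<^sup>2" for p r
  proof -
    have sm: "(\<Sum>q\<in>J. (t * a q + (if q = p then r else 0)) * z q) = (\<Sum>q\<in>J. t * a q * z q) + r * z p" for z
      using p by (simp add: distrib_right sum.distrib if_distrib[of "\<lambda>x. x * _"] cong: if_cong)
    have "(\<integral>\<^sup>+ \<omega>. ennreal (T \<omega> * exp (r * (X \<omega> p - t * a p) - s * s)) \<partial>P)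
      = (\<integral>\<^sup>+ \<omega>. ennreal (exp (- r * t * a p - s * s)) * ennreal (exp (\<Sum>q\<in>J. (t * a q + (if q = p then r else 0)) * X \<omega> q)) \<partial>P)"
      unfolding sm by (intro nn_integral_cong) (simp add: T_def algebra_simps flip: ennreal_mult' exp_add)
    also have "\<dots> = ennreal (exp (- r * t * a p - s * s)) * ennreal (exp (\<Sum>q\<in>J. (t * a q + (if q = p then r else 0))\<^sup>2 / 2))"
      by (subst nn_integral_cmult) (auto simp: mgf)
    also have "(\<Sum>q\<in>J. (t * a q + (if q = p then r else 0))\<^sup>2 / 2) = t\<^sup>2 * n / 2 + r * t * a p + s\<^sup>2 / 2"
    proof -
      have n_sum: "(\<Sum>q\<in>J. t * a q * (t * a q)) = t\<^sup>2 * n"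
        by (simp add: n_def sum_distrib_left power2_eq_square mult_ac)
      have "(\<Sum>q\<in>J. (t * a q + (if q = p then r else 0))\<^sup>2) = (\<Sum>q\<in>J. t * a q * (t * a q + (if q = p then r else 0))) + r * (t * a p + r)"
        using sm[of "\<lambda>q. t * a q + (if q = p then r else 0)"] by (simp add: power2_eq_square)
      also have "(\<Sum>q\<in>J. t * a q * (t * a q + (if q = p then r else 0))) = (\<Sum>q\<in>J. t * a q * (t * a q)) + r * (t * a p)"
        using sm[of "\<lambda>q. t * a q"] by (simp add: mult_ac)
      finally have "(\<Sum>q\<in>J. (t * a q + (if q = p then r else 0))\<^sup>2) = t\<^sup>2 * n + r * (t * a p) + r * (t * a p + r)"
        unfolding n_sum .
      also have "\<dots> = t\<^sup>2 * n + 2 * (r * t * a p) + r\<^sup>2"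
        by (simp add: distrib_left power2_eq_square)
      finally have "(\<Sum>q\<in>J. (t * a q + (if q = p then r else 0))\<^sup>2) = t\<^sup>2 * n + 2 * (r * t * a p) + s\<^sup>2"
        unfolding r .
      then show ?thesis
        by (simp add: add_divide_distrib flip: sum_divide_distrib)
    qed
    finally show ?thesis
      by (simp add: power2_eq_square flip: ennreal_mult' exp_add)
  qed
  have "ennreal (exp (t\<^sup>2 * n / 2)) = (\<integral>\<^sup>+ \<omega>. ennreal (T \<omega>) \<partial>P)"
    unfolding T_def mgf by (simp add: n_def power_mult_distrib sum_distrib_left flip: sum_divide_distrib)
  also have "\<dots> \<le> (\<integral>\<^sup>+ \<omega>. ennreal (exp (t\<^sup>2 * (n + e * l))) * indicator S \<omega> +
      (\<Sum>p\<in>J. ennreal (T \<omega> * exp (s * (X \<omega> p - t * a p) - s * s)) + ennreal (T \<omega> * exp (- s * (X \<omega> p - t * a p) - s * s))) \<partial>P)"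
  proof (intro nn_integral_mono)
    fix \<omega> assume \<omega>: "\<omega> \<in> space P"
    show "ennreal (T \<omega>) \<le> ennreal (exp (t\<^sup>2 * (n + e * l))) * indicator S \<omega> +
      (\<Sum>p\<in>J. ennreal (T \<omega> * exp (s * (X \<omega> p - t * a p) - s * s)) + ennreal (T \<omega> * exp (- s * (X \<omega> p - t * a p) - s * s)))"
    proof (cases "\<omega> \<in> S")
      case True
      have "(\<Sum>p\<in>J. (t * a p) * X \<omega> p) \<le> (\<Sum>p\<in>J. t * (t * (a p)\<^sup>2 + \<bar>a p\<bar> * (e * t)))"
      proof (intro sum_mono)
        fix p assume "p \<in> J"
        then have "\<bar>X \<omega> p - t * a p\<bar> \<le> e * t" using True by (auto simp: S_def)
        then have "a p * (X \<omega> p - t * a p) \<le> \<bar>a p\<bar> * (e * t)"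
          by (metis abs_ge_self abs_ge_zero abs_mult mult_left_mono order_trans)
        then have "a p * X \<omega> p \<le> t * (a p)\<^sup>2 + \<bar>a p\<bar> * (e * t)"
          by (simp add: algebra_simps power2_eq_square)
        then show "(t * a p) * X \<omega> p \<le> t * (t * (a p)\<^sup>2 + \<bar>a p\<bar> * (e * t))"
          using mult_left_mono[OF _ assms(3)] by (simp add: mult.assoc)
      qed
      also have "\<dots> = t\<^sup>2 * (n + e * l)"
        by (simp add: n_def l_def sum.distrib sum_distrib_left distrib_left power2_eq_square mult_ac)
      finally show ?thesis
        using True by (auto simp: T_def intro!: add_increasing2)
    next
      case False
      then obtain p where p: "p \<in> J" "e * t \<le> \<bar>X \<omega> p - t * a p\<bar>"
        using \<omega> by (auto simp: S_def not_less)
      let ?x = "X \<omega> p - t * a p"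
      have "1 \<le> exp (s * ?x - s * s) + exp (- s * ?x - s * s)"
        using indicator_abs_ge_le_exp[OF s, of s ?x] p by (simp add: s_def)
      then have "T \<omega> * 1 \<le> T \<omega> * (exp (s * ?x - s * s) + exp (- s * ?x - s * s))"
        using T0 by (intro mult_left_mono) auto
      then have "ennreal (T \<omega>) \<le> ennreal (T \<omega> * exp (s * ?x - s * s)) + ennreal (T \<omega> * exp (- s * ?x - s * s))"
        using T0 by (simp add: distrib_left flip: ennreal_plus)
      also have "\<dots> \<le> (\<Sum>p\<in>J. ennreal (T \<omega> * exp (s * (X \<omega> p - t * a p) - s * s)) + ennreal (T \<omega> * exp (- s * (X \<omega> p - t * a p) - s * s)))"
        using p(1) by (intro member_le_sum[where f = "\<lambda>p. ennreal (T \<omega> * exp (s * (X \<omega> p - t * a p) - s * s)) + ennreal (T \<omega> * exp (- s * (X \<omega> p - t * a p) - s * s))"]) auto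
      finally show ?thesis
        by (rule add_increasing[rotated]) simp
    qed
  qed
  also have "\<dots> = ennreal (exp (t\<^sup>2 * (n + e * l))) * emeasure P S + (\<Sum>p\<in>J. ennreal (2 * (exp (t\<^sup>2 * n / 2) * exp (- s\<^sup>2 / 2))))"
  proof -
    have "(\<integral>\<^sup>+ \<omega>. ennreal (T \<omega> * exp (s * (X \<omega> p - t * a p) - s * s))
        + ennreal (T \<omega> * exp (- s * (X \<omega> p - t * a p) - s * s)) \<partial>P)
      = ennreal (2 * (exp (t\<^sup>2 * n / 2) * exp (- s\<^sup>2 / 2)))" if p: "p \<in> J" for p
      using p by (subst nn_integral_add) (simp_all only: shift power2_minus mult_2, auto simp flip: ennreal_plus)
    then show ?thesis
      by (subst nn_integral_add) (auto simp: nn_integral_sum nn_integral_cmult_indicator)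
  qed
  also have "\<dots> = ennreal (exp (t\<^sup>2 * (n + e * l)) * P.prob S + 2 * card J * (exp (t\<^sup>2 * n / 2) * exp (- s\<^sup>2 / 2)))"
    by (simp add: P.emeasure_eq_measure ennreal_of_nat_eq_real_of_nat mult_ac flip: ennreal_mult' ennreal_plus)
  finally have "exp (t\<^sup>2 * n / 2) \<le> exp (t\<^sup>2 * (n + e * l)) * P.prob S + 2 * card J * (exp (t\<^sup>2 * n / 2) * exp (- s\<^sup>2 / 2))"
    by (subst (asm) ennreal_le_iff) (auto intro!: add_nonneg_nonneg)
  then have "exp (t\<^sup>2 * n / 2) * (1 - 2 * card J * exp (- s\<^sup>2 / 2)) \<le> exp (t\<^sup>2 * (n + e * l)) * P.prob S"
    by (simp add: algebra_simps)
  then have "exp (- t\<^sup>2 * (n + e * l)) * (exp (t\<^sup>2 * n / 2) * (1 - 2 * card J * exp (- s\<^sup>2 / 2)))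
      \<le> exp (- t\<^sup>2 * (n + e * l)) * (exp (t\<^sup>2 * (n + e * l)) * P.prob S)"
    by (intro mult_left_mono) auto
  moreover have "exp (- t\<^sup>2 * (n + e * l)) * exp (t\<^sup>2 * n / 2) = exp (- t\<^sup>2 * (n / 2 + e * l))"
    by (simp add: algebra_simps flip: exp_add)
  moreover have "exp (- t\<^sup>2 * (n + e * l)) * exp (t\<^sup>2 * (n + e * l)) = 1"
    by (simp flip: exp_add)
  ultimately have "exp (- t\<^sup>2 * (n / 2 + e * l)) * (1 - 2 * card J * exp (- s\<^sup>2 / 2)) \<le> P.prob S"
    by (simp only: mult_1 flip: mult.assoc)
  then show ?thesis
    by (simp add: P.emeasure_eq_measure S_def n_def l_def s_def)
qed

section \<open>Orthogonal matrices and near-orthonormal systems\<close>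

definition mat_vec :: "nat \<Rightarrow> (nat \<Rightarrow> nat \<Rightarrow> real) \<Rightarrow> (nat \<Rightarrow> real) \<Rightarrow> nat \<Rightarrow> real" where
  "mat_vec N B v l = (\<Sum>n<N. B l n * v n)"

lemma orthogonal_group_transpose:
  "B \<in> orthogonal_group N \<Longrightarrow> (\<lambda>i j. B j i) \<in> orthogonal_group N"
  by (auto simp: orthogonal_group_def)

lemma orthogonal_group_inner:
  assumes "B \<in> orthogonal_group N"
  shows "(\<Sum>l<N. mat_vec N B v l * mat_vec N B w l) = (\<Sum>n<N. v n * w n)"
proof -
  have B: "(\<Sum>j<N. B j n * B j i) = (if n = i then 1 else 0)" if "n<N" "i<N" for n i
    using assms that by (auto simp: orthogonal_group_def)
  have "(\<Sum>l<N. mat_vec N B v l * mat_vec N B w l) = (\<Sum>l<N. \<Sum>n<N. \<Sum>i<N. v n * w i * (B l n * B l i))"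
    by (simp add: mat_vec_def sum_product mult_ac)
  also have "\<dots> = (\<Sum>n<N. \<Sum>i<N. \<Sum>l<N. v n * w i * (B l n * B l i))"
    by (rule trans[OF sum.swap], rule sum.cong[OF refl], rule sum.swap)
  also have "\<dots> = (\<Sum>n<N. \<Sum>i<N. v n * w i * (if n = i then 1 else 0))"
    by (intro sum.cong refl) (simp add: B flip: sum_distrib_left)
  also have "\<dots> = (\<Sum>n<N. v n * w n)"
    by (simp add: if_distrib cong: if_cong)
  finally show ?thesis .
qed

lemma mat_vec_compose:
  "mat_vec N (\<lambda>l n. \<Sum>i<N. Q l i * B i n) v l = mat_vec N Q (mat_vec N B v) l"
  unfolding mat_vec_def sum_distrib_left sum_distrib_right
  by (subst sum.swap) (simp add: mult_ac)

lemma orthogonal_group_compose: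
  assumes "Q \<in> orthogonal_group N" "B \<in> orthogonal_group N"
  shows "(\<lambda>l n. \<Sum>i<N. Q l i * B i n) \<in> orthogonal_group N"
proof -
  have 1: "(\<Sum>n<N. (\<Sum>i<N. Q k i * B i n) * (\<Sum>i<N. Q l i * B i n)) = (if k = l then 1 else 0)" if "k < N" "l < N" for k l
  proof -
    have "(\<Sum>n<N. (\<Sum>i<N. Q k i * B i n) * (\<Sum>i<N. Q l i * B i n)) = (\<Sum>i<N. Q k i * Q l i)"
      using orthogonal_group_inner[OF orthogonal_group_transpose[OF assms(2)], of "Q k" "Q l"]
      by (simp add: mat_vec_def mult.commute)
    then show ?thesis using assms(1) that by (simp add: orthogonal_group_def)
  qed
  have 2: "(\<Sum>n<N. (\<Sum>i<N. Q n i * B i k) * (\<Sum>i<N. Q n i * B i l)) = (if k = l then 1 else 0)" if "k < N" "l < N" for k l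
  proof -
    have "(\<Sum>n<N. (\<Sum>i<N. Q n i * B i k) * (\<Sum>i<N. Q n i * B i l)) = (\<Sum>i<N. B i k * B i l)"
      using orthogonal_group_inner[OF assms(1), of "\<lambda>i. B i k" "\<lambda>i. B i l"]
      by (simp add: mat_vec_def)
    then show ?thesis using assms(2) that by (simp add: orthogonal_group_def)
  qed
  show ?thesis
    using 1 2 by (simp add: orthogonal_group_def)
qed

text \<open>For \<open>w = 0\<close> the convention \<open>x / 0 = 0\<close> makes \<open>Q\<close> the identity, which is the right
  reflection for a vector that is aligned already.\<close>

lemma householder_reflection:
  fixes w :: "nat \<Rightarrow> real" and N :: nat
  defines "W \<equiv> \<Sum>n<N. (w n)\<^sup>2"
  defines "Q \<equiv> \<lambda>l n. (if l = n then 1 else 0) - 2 * w l * w n / W"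
  shows "Q \<in> orthogonal_group N"
    and "\<And>x l. l < N \<Longrightarrow> mat_vec N Q x l = x l - 2 * w l * (\<Sum>n<N. w n * x n) / W"
proof -
  show mv: "mat_vec N Q x l = x l - 2 * w l * (\<Sum>n<N. w n * x n) / W" if "l < N" for x l
  proof -
    have "mat_vec N Q x l = (\<Sum>n<N. (if l = n then x n else 0) - 2 * w l / W * (w n * x n))"
      unfolding mat_vec_def Q_def by (intro sum.cong refl) (simp add: algebra_simps)
    also have "\<dots> = x l - 2 * w l / W * (\<Sum>n<N. w n * x n)"
      using that by (simp add: sum_subtractf sum_distrib_left)
    finally show ?thesis by simp
  qed
  have "(\<Sum>j<N. Q l j * Q k j) = (if l = k then 1 else 0)" if "l < N" "k < N" for k l
  proof -
    have "(\<Sum>j<N. w j * Q k j) = mat_vec N Q w k"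
      unfolding mat_vec_def Q_def by (intro sum.cong refl) (auto simp: mult_ac)
    also have "\<dots> = - w k"
    proof (cases "W = 0")
      case True
      then have "w k = 0"
        using that by (simp add: W_def sum_nonneg_eq_0_iff)
      then show ?thesis using that by (simp add: mv)
    qed (use that in \<open>simp add: mv W_def power2_eq_square\<close>)
    finally have "mat_vec N Q (\<lambda>j. Q k j) l = Q k l + 2 * w l * w k / W"
      using that by (simp add: mv)
    then show ?thesis
      by (auto simp: mat_vec_def Q_def)
  qed
  moreover have "Q l j = Q j l" for l j
    by (simp add: Q_def)
  ultimately show "Q \<in> orthogonal_group N"
    unfolding orthogonal_group_def by auto
qed

text \<open>One step of the Householder QR decomposition: the reflection exchanging the part of \<open>y\<close> beyond
  index \<open>k\<close> with the multiple of the \<open>k\<close>-th unit vector that has the same length. It fixes every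
  vector supported on the first \<open>k\<close> coordinates.\<close>

lemma orthogonal_tail_alignment:
  fixes y :: "nat \<Rightarrow> real"
  assumes "k < N"
  obtains Q where "Q \<in> orthogonal_group N"
    and "\<And>x l. (\<And>i. k \<le> i \<Longrightarrow> i < N \<Longrightarrow> x i = 0) \<Longrightarrow> l < N \<Longrightarrow> mat_vec N Q x l = x l"
    and "\<And>l. l < N \<Longrightarrow> mat_vec N Q y l = (if l < k then y l else if l = k then sqrt (\<Sum>n=k..<N. (y n)\<^sup>2) else 0)"
proof -
  define r where "r = sqrt (\<Sum>n=k..<N. (y n)\<^sup>2)"
  have r2: "r\<^sup>2 = (\<Sum>n=k..<N. (y n)\<^sup>2)"
    unfolding r_def by (simp add: sum_nonneg)
  define w where "w n = (if n < k then 0 else if n = k then y k - r else y n)" for n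
  define W where "W = (\<Sum>n<N. (w n)\<^sup>2)"
  define Q where "Q l n = (if l = n then 1 else 0) - 2 * w l * w n / W" for l n
  have split: "(\<Sum>n<N. g n) = (\<Sum>n<k. g n) + g k + (\<Sum>n=Suc k..<N. g n)" for g :: "nat \<Rightarrow> real"
  proof -
    have "(\<Sum>n<N. g n) = (\<Sum>n<k. g n) + (\<Sum>n=k..<N. g n)"
      using sum.atLeastLessThan_concat[of 0 k N g] assms by (simp add: atLeast0LessThan)
    then show ?thesis using assms by (simp add: sum.atLeast_Suc_lessThan)
  qed
  have r2': "r\<^sup>2 = (y k)\<^sup>2 + (\<Sum>n=Suc k..<N. (y n)\<^sup>2)"
    unfolding r2 using assms by (simp add: sum.atLeast_Suc_lessThan)
  have tail: "(\<Sum>n=Suc k..<N. (w n)\<^sup>2) = (\<Sum>n=Suc k..<N. (y n)\<^sup>2)" "(\<Sum>n=Suc k..<N. w n * y n) = (\<Sum>n=Suc k..<N. (y n)\<^sup>2)"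
    by (auto intro!: sum.cong simp: w_def power2_eq_square)
  have W: "W = 2 * (\<Sum>n<N. w n * y n)"
    unfolding W_def split tail using r2' by (simp add: w_def power2_eq_square algebra_simps)
  note hh = householder_reflection[where w = w and N = N, folded W_def, folded Q_def]
  show ?thesis
  proof
    show "Q \<in> orthogonal_group N"
      using hh(1) by (simp add: Q_def[abs_def])
    have mv: "mat_vec N Q x l = x l - 2 * w l * (\<Sum>n<N. w n * x n) / W" if "l < N" for x l
      using hh(2)[OF that] by (simp add: Q_def[abs_def])
    show "mat_vec N Q x l = x l" if "\<And>i. k \<le> i \<Longrightarrow> i < N \<Longrightarrow> x i = 0" "l < N" for x l
    proof -
      have "(\<Sum>n<N. w n * x n) = 0"
        using that by (intro sum.neutral) (auto simp: w_def)
      then show ?thesis using that by (simp add: mv)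
    qed
    show "mat_vec N Q y l = (if l < k then y l else if l = k then sqrt (\<Sum>n=k..<N. (y n)\<^sup>2) else 0)" if "l < N" for l
    proof -
      have "mat_vec N Q y l = y l - w l"
      proof (cases "W = 0")
        case True
        then have "w l = 0"
          using that by (simp add: W_def sum_nonneg_eq_0_iff)
        then show ?thesis using that by (simp add: mv)
      next
        case False
        have "mat_vec N Q y l = y l - w l * (2 * (\<Sum>n<N. w n * y n)) / W"
          using that by (simp add: mv)
        then show ?thesis using False unfolding W[symmetric] by simp
      qed
      then show ?thesis
        by (simp add: w_def r_def)
    qed
  qed
qed

text \<open>The QR decomposition is stable near orthonormal systems, uniformly in the ambient dimension \<open>N\<close>.
  The containment in the span of the first \<open>k\<close> unit vectors is exact, and only the coefficients are
  approximate: this makes the error in \<open>gram_close_comparison\<close> proportional to the norm of the first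
  \<open>k\<close> columns. A fixed error would be useless, because these columns are of size \<open>1 / \<beta>\<close>.

  In the induction step let \<open>x\<close> be the image of the new vector under the rotation found so far. Its
  inner products with the images of the old vectors are small, and these are close to unit vectors, so
  the first \<open>k\<close> coordinates of \<open>x\<close> are small and the rest has length close to 1. A Householder
  reflection moves the rest onto the next axis.\<close>

lemma near_orthonormal_rotation:
  fixes \<epsilon> :: real
  assumes "\<epsilon> > 0"
  shows "\<exists>\<delta>>0. \<forall>N\<ge>k. \<forall>h::nat \<Rightarrow> nat \<Rightarrow> real.
     (\<forall>i<k. \<forall>j<k. \<bar>(\<Sum>l<N. h i l * h j l) - (if i = j then 1 else 0)\<bar> \<le> \<delta>) \<longrightarrow>
     (\<exists>B\<in>orthogonal_group N. \<forall>j<k. (\<forall>l<N. k \<le> l \<longrightarrow> mat_vec N B (h j) l = 0) \<and>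
        (\<forall>l<k. \<bar>mat_vec N B (h j) l - (if l = j then 1 else 0)\<bar> \<le> \<epsilon>))"
  using assms
proof (induction k arbitrary: \<epsilon>)
  case 0
  have "(\<lambda>i j. if i = j then 1 else 0) \<in> orthogonal_group N" for N
    by (auto simp: orthogonal_group_def if_distrib[of "\<lambda>x. x * _"] cong: if_cong)
  then show ?case by (intro exI[of _ 1]) auto
next
  case (Suc k)
  \<comment> \<open>\<open>\<eta>\<close> will bound the first \<open>k\<close> coordinates of the new vector, \<open>\<epsilon>'\<close> is the accuracy for the old ones\<close>
  define \<epsilon>0 where "\<epsilon>0 = min \<epsilon> 1"
  define \<eta> where "\<eta> = \<epsilon>0 / (2 * (real k + 1))"
  define \<epsilon>' where "\<epsilon>' = \<eta> / (4 * (real k + 1))"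
  have e0: "0 < \<epsilon>0" "\<epsilon>0 \<le> 1" "\<epsilon>0 \<le> \<epsilon>" using Suc.prems by (auto simp: \<epsilon>0_def)
  have \<eta>: "0 < \<eta>" "real k * \<eta> \<le> \<epsilon>0 / 2" "\<eta> \<le> \<epsilon>0 / 2"
    using e0 by (auto simp: \<eta>_def field_simps)
  have \<epsilon>': "0 < \<epsilon>'" "2 * real k * \<epsilon>' \<le> \<eta> / 2" "\<epsilon>' \<le> \<eta>"
    using \<eta> by (auto simp: \<epsilon>'_def field_simps)
  obtain \<delta>' where \<delta>': "\<delta>' > 0" and IH: "\<And>N h. N \<ge> k \<Longrightarrow>
       (\<forall>i<k. \<forall>j<k. \<bar>(\<Sum>l<N. h i l * h j l) - (if i = j then 1 else (0::real))\<bar> \<le> \<delta>') \<Longrightarrow>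
       (\<exists>B\<in>orthogonal_group N. \<forall>j<k. (\<forall>l<N. k \<le> l \<longrightarrow> mat_vec N B (h j) l = 0) \<and>
        (\<forall>l<k. \<bar>mat_vec N B (h j) l - (if l = j then 1 else 0)\<bar> \<le> \<epsilon>'))"
    using Suc.IH[OF \<epsilon>'(1)] by (elim exE conjE) (rule that, assumption, simp)
  define \<delta> where "\<delta> = min \<delta>' (\<eta> / 2)"
  have \<delta>: "0 < \<delta>" "\<delta> \<le> \<delta>'" "\<delta> \<le> \<eta> / 2" using \<delta>' \<eta> by (auto simp: \<delta>_def)
  show ?case
  proof (intro exI[of _ \<delta>] conjI \<delta> allI impI)
    fix N h assume N: "Suc k \<le> N"
      and h: "\<forall>i<Suc k. \<forall>j<Suc k. \<bar>(\<Sum>l<N. h i l * h j l) - (if i = j then 1 else (0::real))\<bar> \<le> \<delta>"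
    obtain B where B: "B \<in> orthogonal_group N"
      and B0: "\<And>j l. j < k \<Longrightarrow> l < N \<Longrightarrow> k \<le> l \<Longrightarrow> mat_vec N B (h j) l = 0"
      and B1: "\<And>j l. j < k \<Longrightarrow> l < k \<Longrightarrow> \<bar>mat_vec N B (h j) l - (if l = j then 1 else 0)\<bar> \<le> \<epsilon>'"
    proof -
      have "\<forall>i<k. \<forall>j<k. \<bar>(\<Sum>l<N. h i l * h j l) - (if i = j then 1 else (0::real))\<bar> \<le> \<delta>'"
        using h \<delta>(2) by (meson less_SucI order_trans)
      then show ?thesis using IH[of N h] N that by auto
    qed
    define x where "x = mat_vec N B (h k)"
    have normx: "\<bar>(\<Sum>l<N. x l * x l) - 1\<bar> \<le> \<delta>"
      using h[rule_format, of k k] unfolding x_def orthogonal_group_inner[OF B] by simp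
    have x2: "\<bar>x l\<bar> \<le> 2" if "l < N" for l
    proof -
      have "(x l)\<^sup>2 \<le> (\<Sum>l<N. (x l)\<^sup>2)"
        using that by (intro member_le_sum) auto
      also have "\<dots> \<le> 2\<^sup>2"
        using normx \<delta> \<eta> e0 by (simp add: power2_eq_square)
      finally show ?thesis by (subst (asm) power2_le_iff_abs_le) auto
    qed
    have small: "\<bar>x j\<bar> \<le> \<eta>" if j: "j < k" for j
    proof -
      let ?R = "\<lambda>i. mat_vec N B (h j) i"
      have "(\<Sum>i<N. x i * ?R i) = (\<Sum>i<k. x i * ?R i)"
        using N B0[OF j] by (intro sum.mono_neutral_right) auto
      moreover have "(\<Sum>i<k. x i * (if i = j then 1 else 0)) = x j"
        using j by (simp add: if_distrib cong: if_cong)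
      ultimately have "x j = (\<Sum>i<N. x i * ?R i) - (\<Sum>i<k. x i * (?R i - (if i = j then 1 else 0)))"
        by (simp add: right_diff_distrib sum_subtractf)
      moreover have "\<bar>\<Sum>i<N. x i * ?R i\<bar> \<le> \<delta>"
        using h[rule_format, of k j] j unfolding x_def orthogonal_group_inner[OF B] by simp
      moreover have "\<bar>\<Sum>i<k. x i * (?R i - (if i = j then 1 else 0))\<bar> \<le> (\<Sum>i<k. 2 * \<epsilon>')"
      proof (rule order_trans[OF sum_abs sum_mono])
        fix i assume "i \<in> {..<k}"
        then show "\<bar>x i * (?R i - (if i = j then 1 else 0))\<bar> \<le> 2 * \<epsilon>'"
          unfolding abs_mult using N j \<epsilon>' by (intro mult_mono x2 B1) auto
      qed
      ultimately show ?thesis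
        using \<delta> \<epsilon>' by (simp add: abs_le_iff)
    qed
    define r where "r = sqrt (\<Sum>n=k..<N. (x n)\<^sup>2)"
    have r1: "\<bar>r - 1\<bar> \<le> \<epsilon>"
    proof -
      have r0: "0 \<le> r" by (simp add: r_def sum_nonneg)
      have "(\<Sum>n<N. (x n)\<^sup>2) = (\<Sum>n<k. (x n)\<^sup>2) + r\<^sup>2"
        using sum.atLeastLessThan_concat[of 0 k N "\<lambda>n. (x n)\<^sup>2"] N by (simp add: r_def atLeast0LessThan sum_nonneg)
      moreover have "(\<Sum>n<k. (x n)\<^sup>2) \<le> (\<Sum>n<k. \<eta>)"
      proof (intro sum_mono)
        fix n assume "n \<in> {..<k}"
        then have "(x n)\<^sup>2 \<le> \<eta>\<^sup>2" using small[of n] \<eta> by (simp add: power2_le_iff_abs_le)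
        also have "\<eta>\<^sup>2 \<le> \<eta>" using \<eta> e0 by (simp add: power2_eq_square mult_left_le)
        finally show "(x n)\<^sup>2 \<le> \<eta>" .
      qed
      moreover have "0 \<le> (\<Sum>n<k. (x n)\<^sup>2)" by (simp add: sum_nonneg)
      moreover have "\<bar>(\<Sum>l<N. (x l)\<^sup>2) - 1\<bar> \<le> \<delta>" using normx by (simp add: power2_eq_square)
      ultimately have "\<bar>r\<^sup>2 - 1\<bar> \<le> \<epsilon>0"
        using \<eta> \<delta> e0 by (simp add: abs_le_iff)
      moreover have "\<bar>r - 1\<bar> \<le> \<bar>r - 1\<bar> * \<bar>r + 1\<bar>"
        using r0 by (intro mult_le_cancel_left1[THEN iffD2]) auto
      moreover have "\<dots> = \<bar>r\<^sup>2 - 1\<bar>"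
        by (simp add: power2_eq_square algebra_simps flip: abs_mult)
      ultimately show ?thesis using e0 by linarith
    qed
    obtain Q where Q: "Q \<in> orthogonal_group N"
      and Q0: "\<And>x l. (\<And>i. k \<le> i \<Longrightarrow> i < N \<Longrightarrow> x i = 0) \<Longrightarrow> l < N \<Longrightarrow> mat_vec N Q x l = x l"
      and Q1: "\<And>l. l < N \<Longrightarrow> mat_vec N Q x l = (if l < k then x l else if l = k then r else 0)"
    proof (rule orthogonal_tail_alignment[of k N x])
      show "k < N" using N by simp
    next
      fix Q assume q1: "Q \<in> orthogonal_group N"
        and q2: "\<And>x l. (\<And>i. k \<le> i \<Longrightarrow> i < N \<Longrightarrow> x i = 0) \<Longrightarrow> l < N \<Longrightarrow> mat_vec N Q x l = x l"
        and q3: "\<And>l. l < N \<Longrightarrow> mat_vec N Q x l = (if l < k then x l else if l = k then sqrt (\<Sum>n=k..<N. (x n)\<^sup>2) else 0)"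
      show ?thesis
        by (rule that[of Q, OF q1 _ q3[folded r_def]]) (auto intro: q2)
    qed
    let ?C = "\<lambda>l n. \<Sum>i<N. Q l i * B i n"
    have Cj: "mat_vec N ?C (h j) l = mat_vec N B (h j) l" if "j < k" "l < N" for j l
      unfolding mat_vec_compose using B0 that by (intro Q0) auto
    have Ck: "mat_vec N ?C (h k) l = (if l < k then x l else if l = k then r else 0)" if "l < N" for l
      unfolding mat_vec_compose using Q1 that by (simp add: x_def)
    show "\<exists>B\<in>orthogonal_group N. \<forall>j<Suc k. (\<forall>l<N. Suc k \<le> l \<longrightarrow> mat_vec N B (h j) l = 0) \<and>
        (\<forall>l<Suc k. \<bar>mat_vec N B (h j) l - (if l = j then 1 else 0)\<bar> \<le> \<epsilon>)"
    proof (intro bexI[of _ ?C] allI impI conjI orthogonal_group_compose Q B)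
      fix j l assume j: "j < Suc k" and l: "l < N" "Suc k \<le> l"
      show "mat_vec N ?C (h j) l = 0"
        using j l Cj[of j l] Ck[of l] B0[of j l] by (cases "j = k") auto
    next
      fix j l assume j: "j < Suc k" and l: "l < Suc k"
      have le: "\<epsilon>' \<le> \<epsilon>" "\<eta> \<le> \<epsilon>" using \<epsilon>' \<eta> e0 by auto
      show "\<bar>mat_vec N ?C (h j) l - (if l = j then 1 else 0)\<bar> \<le> \<epsilon>"
      proof (cases "j = k")
        case True
        then show ?thesis using l N Ck[of l] small[of l] r1 le by auto
      next
        case False
        then have j: "j < k" using j by simp
        show ?thesis
        proof (cases "l = k")
          case True
          then show ?thesis using j N Cj[of j l] B0[of j l] Suc.prems by auto
        next
          case False
          then have "l < k" using l by simp
          then show ?thesis using j N Cj[of j l] B1[of j l] le by auto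
        qed
      qed
    qed
  qed
qed

section \<open>Concentration of Gaussian Gram matrices\<close>

lemma exp_mult_le_quadratic:
  fixes u s :: real
  assumes "\<bar>s\<bar> \<le> 1 / 2"
  shows "exp (s * u) \<le> 1 + s * u + 4 * s\<^sup>2 * exp \<bar>u\<bar>"
proof -
  obtain t where t: "\<bar>t\<bar> \<le> \<bar>s * u\<bar>" "exp (s * u) = (\<Sum>m<2. (s * u) ^ m / fact m) + exp t / fact 2 * (s * u) ^ 2"
    using Maclaurin_exp_le[of "s * u" 2] by auto
  have "\<bar>s * u\<bar> \<le> \<bar>u\<bar> / 2"
    using mult_right_mono[OF assms, of "\<bar>u\<bar>"] by (simp add: abs_mult)
  then have "exp t \<le> exp (\<bar>u\<bar> / 2)" using t(1) by simp
  moreover have "u\<^sup>2 \<le> 8 * exp (\<bar>u\<bar> / 2)"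
    using exp_lower_Taylor_quadratic[of "\<bar>u\<bar> / 2"] by (simp add: power_divide)
  ultimately have "u\<^sup>2 * exp t \<le> 8 * exp (\<bar>u\<bar> / 2) * exp (\<bar>u\<bar> / 2)"
    by (intro mult_mono) auto
  also have "\<dots> = 8 * exp \<bar>u\<bar>"
    by (simp flip: exp_add)
  finally have "s\<^sup>2 / 2 * (u\<^sup>2 * exp t) \<le> s\<^sup>2 / 2 * (8 * exp \<bar>u\<bar>)"
    by (intro mult_left_mono) auto
  then show ?thesis
    using t(2) by (simp add: numeral_2_eq_2 power_mult_distrib mult_ac)
qed

text \<open>Chernoff's method: since \<open>f\<close> is centred, its moment generating function at \<open>s\<close> is at most
  \<open>1 + 4 K s\<^sup>2\<close> with \<open>K\<close> the integral of \<open>exp \<bar>f\<bar>\<close>, so a small positive \<open>s\<close> beats the factor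
  \<open>exp (- s \<delta>)\<close> per sample.\<close>

lemma cramer_upper_tail:
  fixes f :: "'a \<Rightarrow> real"
  assumes "prob_space \<rho>" "integrable \<rho> f" "(\<integral>x. f x \<partial>\<rho>) = 0" "integrable \<rho> (\<lambda>x. exp \<bar>f x\<bar>)" "\<delta> > 0"
  shows "\<exists>c>0. \<forall>N. emeasure (Pi\<^sub>M {..<N} (\<lambda>_. \<rho>)) {\<omega>\<in>space (Pi\<^sub>M {..<N} (\<lambda>_. \<rho>)). \<delta> * real N \<le> (\<Sum>l<N. f (\<omega> l))}
     \<le> ennreal (exp (- c * real N))"
proof -
  interpret \<rho>: prob_space \<rho> by fact
  interpret product_prob_space "\<lambda>_::nat. \<rho>" by (intro product_prob_spaceI assms)
  have f[measurable]: "f \<in> borel_measurable \<rho>" using assms by auto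
  define K where "K = (\<integral>x. exp \<bar>f x\<bar> \<partial>\<rho>)"
  have "(\<integral>x. 1 \<partial>\<rho>) \<le> K"
    unfolding K_def using assms by (intro integral_mono) auto
  then have K: "1 \<le> K" by (simp add: \<rho>.prob_space)
  \<comment> \<open>small enough for \<open>4 K s\<^sup>2\<close> to cost at most half of the gain \<open>s \<delta>\<close>\<close>
  define s where "s = min (1 / 2) (\<delta> / (8 * K))"
  have s: "0 < s" "s \<le> 1 / 2" "s \<le> \<delta> / (8 * K)"
    using assms K by (auto simp: s_def)
  have "8 * K * s \<le> \<delta>"
    using s(3) K by (simp add: field_simps)
  then have s2: "4 * K * s\<^sup>2 \<le> s * \<delta> / 2"
    using mult_right_mono[of "8 * K * s" \<delta> "s / 2"] s by (simp add: power2_eq_square mult_ac)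
  have one: "(\<integral>\<^sup>+ x. ennreal (exp (s * f x)) \<partial>\<rho>) \<le> ennreal (exp (s * \<delta> / 2))"
  proof -
    have b: "exp (s * f x) \<le> 1 + s * f x + 4 * s\<^sup>2 * exp \<bar>f x\<bar>" for x
      using s by (intro exp_mult_le_quadratic) auto
    then have nn: "0 \<le> 1 + s * f x + 4 * s\<^sup>2 * exp \<bar>f x\<bar>" for x
      by (meson exp_ge_zero order_trans)
    have "(\<integral>\<^sup>+ x. ennreal (exp (s * f x)) \<partial>\<rho>) \<le> (\<integral>\<^sup>+ x. ennreal (1 + s * f x + 4 * s\<^sup>2 * exp \<bar>f x\<bar>) \<partial>\<rho>)"
      using b by (intro nn_integral_mono ennreal_leI) auto
    also have "\<dots> = ennreal (\<integral>x. 1 + s * f x + 4 * s\<^sup>2 * exp \<bar>f x\<bar> \<partial>\<rho>)"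
      using assms nn by (intro nn_integral_eq_integral) auto
    also have "(\<integral>x. 1 + s * f x + 4 * s\<^sup>2 * exp \<bar>f x\<bar> \<partial>\<rho>) = 1 + 4 * s\<^sup>2 * K"
      using assms by (simp add: K_def \<rho>.prob_space)
    also have "1 + 4 * s\<^sup>2 * K \<le> exp (s * \<delta> / 2)"
    proof -
      have "4 * s\<^sup>2 * K = 4 * K * s\<^sup>2" by simp
      then show ?thesis using exp_ge_add_one_self[of "s * \<delta> / 2"] s2 by linarith
    qed
    finally show ?thesis by (simp add: ennreal_leI)
  qed
  show ?thesis
  proof (intro exI[of _ "s * \<delta> / 2"] conjI allI)
    show "0 < s * \<delta> / 2" using s assms by simp
    fix N :: nat
    let ?P = "Pi\<^sub>M {..<N} (\<lambda>_. \<rho>)"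
    let ?S = "{\<omega>\<in>space ?P. \<delta> * real N \<le> (\<Sum>l<N. f (\<omega> l))}"
    have "emeasure ?P ?S = (\<integral>\<^sup>+ \<omega>. indicator ?S \<omega> \<partial>?P)"
      by (simp add: nn_integral_indicator)
    also have "\<dots> \<le> (\<integral>\<^sup>+ \<omega>. ennreal (exp (- s * \<delta> * real N)) * (\<Prod>l<N. ennreal (exp (s * f (\<omega> l)))) \<partial>?P)"
    proof (intro nn_integral_mono)
      fix \<omega>
      have "1 \<le> exp (- s * \<delta> * real N) * (\<Prod>l<N. exp (s * f (\<omega> l)))" if "\<delta> * real N \<le> (\<Sum>l<N. f (\<omega> l))"
        using mult_left_mono[OF that, of s] s by (simp add: mult_ac sum_distrib_left flip: exp_sum exp_add)
      then show "indicator ?S \<omega> \<le> ennreal (exp (- s * \<delta> * real N)) * (\<Prod>l<N. ennreal (exp (s * f (\<omega> l))))"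
        by (auto simp: indicator_def prod_ennreal simp flip: ennreal_mult')
    qed
    also have "\<dots> = ennreal (exp (- s * \<delta> * real N)) * (\<Prod>l<N. \<integral>\<^sup>+ x. ennreal (exp (s * f x)) \<partial>\<rho>)"
      by (subst nn_integral_cmult, simp, subst product_nn_integral_prod) auto
    also have "\<dots> \<le> ennreal (exp (- s * \<delta> * real N)) * (\<Prod>l<N. ennreal (exp (s * \<delta> / 2)))"
      using one by (auto intro!: mult_left_mono power_mono)
    also have "\<dots> = ennreal (exp (- (s * \<delta> / 2) * real N))"
      by (simp add: ennreal_power algebra_simps flip: ennreal_mult' exp_of_nat_mult exp_add)
    finally show "emeasure ?P ?S \<le> ennreal (exp (- (s * \<delta> / 2) * real N))" .
  qed
qed

definition gauss_row :: "nat \<Rightarrow> (nat \<Rightarrow> real) measure" where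
  "gauss_row k = Pi\<^sub>M {..<k} (\<lambda>_. std_normal_distribution)"

text \<open>The nesting makes the \<open>N\<close> rows independent and identically distributed, so that the Gram matrix of
  the columns is a sum of \<open>N\<close> i.i.d. terms.\<close>

definition gauss_matrix :: "nat \<Rightarrow> nat \<Rightarrow> (nat \<Rightarrow> nat \<Rightarrow> real) measure" where
  "gauss_matrix N k = Pi\<^sub>M {..<N} (\<lambda>_. gauss_row k)"

lemma prob_space_gauss_row: "prob_space (gauss_row k)"
  unfolding gauss_row_def by (intro prob_space_PiM gauss.prob_space_axioms)

lemma prob_space_gauss_matrix: "prob_space (gauss_matrix N k)"
  unfolding gauss_matrix_def by (intro prob_space_PiM prob_space_gauss_row)

lemma measurable_gauss_row[measurable]: "j < k \<Longrightarrow> (\<lambda>x. x j) \<in> borel_measurable (gauss_row k)"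
proof -
  assume "j < k"
  then have "(\<lambda>x. x j) \<in> Pi\<^sub>M {..<k} (\<lambda>_. std_normal_distribution) \<rightarrow>\<^sub>M std_normal_distribution"
    by (intro measurable_component_singleton) simp
  then show ?thesis by (simp add: gauss_row_def)
qed

lemma measurable_gauss_matrix[measurable]:
  assumes "n < N" "j < k" shows "(\<lambda>H. H n j) \<in> borel_measurable (gauss_matrix N k)"
proof -
  have "(\<lambda>H. H n) \<in> gauss_matrix N k \<rightarrow>\<^sub>M gauss_row k"
    unfolding gauss_matrix_def using assms by (intro measurable_component_singleton) simp
  from measurable_compose[OF this measurable_gauss_row[OF assms(2)]] show ?thesis .
qed

lemma gauss_row_covariance:
  assumes "i < k" "j < k"
  shows "integrable (gauss_row k) (\<lambda>x. x i * x j)"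
    and "(\<integral>x. x i * x j \<partial>gauss_row k) = (if i = j then 1 else 0)"
proof -
  interpret product_prob_space "\<lambda>_::nat. std_normal_distribution" by (intro product_prob_spaceI gauss.prob_space_axioms)
  define g where "g p x = (if p = i then x else 1) * (if p = j then x else (1::real))" for p x
  have eq: "x i * x j = (\<Prod>p<k. g p (x p))" for x
    unfolding g_def using assms by (simp add: prod.distrib)
  have int1: "integrable std_normal_distribution (\<lambda>x. x)" "(\<integral>x. x \<partial>std_normal_distribution) = 0"
    using integrable_std_normal_distribution_moment[of 1] integral_std_normal_distribution_moment_odd[of 1] by simp_all
  have int2: "integrable std_normal_distribution (\<lambda>x. x * x)" "(\<integral>x. x * x \<partial>std_normal_distribution) = 1"
    using std_normal_distribution_even_moments[of 1] by (simp_all add: power2_eq_square)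
  have g: "integrable std_normal_distribution (g p)" for p
    unfolding g_def using int1 int2 by (cases "p = i"; cases "p = j") auto
  have gi: "(\<integral>x. g p x \<partial>std_normal_distribution) = (if p = i \<and> i \<noteq> j then 0 else if p = j \<and> i \<noteq> j then 0 else 1)" for p
    unfolding g_def using int1 int2 gauss.prob_space by (cases "p = i"; cases "p = j") auto
  show "integrable (gauss_row k) (\<lambda>x. x i * x j)"
    unfolding gauss_row_def eq by (intro product_integrable_prod g) auto
  have "(\<integral>x. x i * x j \<partial>gauss_row k) = (\<Prod>p<k. \<integral>x. g p x \<partial>std_normal_distribution)"
    unfolding gauss_row_def eq by (intro product_integral_prod g) auto
  also have "\<dots> = (if i = j then 1 else 0)"
    unfolding gi using assms by (auto intro!: prod_zero)
  finally show "(\<integral>x. x i * x j \<partial>gauss_row k) = (if i = j then 1 else 0)" .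
qed

text \<open>The factor 1/4 keeps the quadratic form \<open>s x i x j\<close> below the threshold at which the Gaussian
  density stops dominating its exponential.\<close>

lemma gauss_row_exp_abs_integrable:
  assumes ij: "i < k" "j < k" and "\<bar>s\<bar> = 1 / 4" "\<bar>b\<bar> \<le> 1"
  shows "integrable (gauss_row k) (\<lambda>x. exp \<bar>s * (x i * x j - b)\<bar>)"
proof -
  interpret product_prob_space "\<lambda>_::nat. std_normal_distribution" by (intro product_prob_spaceI gauss.prob_space_axioms)
  have "(\<integral>\<^sup>+ x. ennreal (exp (x\<^sup>2 / 4)) \<partial>std_normal_distribution) < \<infinity>"
    using nn_integral_std_normal_exp_quadratic[of "1/2" 0] by simp
  then have e: "integrable std_normal_distribution (\<lambda>x. exp (x\<^sup>2 / 4))"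
    by (intro integrableI_nonneg) auto
  have "integrable (gauss_row k) (\<lambda>x. exp (1 / 4) * (\<Prod>p<k. exp ((x p)\<^sup>2 / 4)))"
    unfolding gauss_row_def by (intro integrable_mult_right product_integrable_prod e) auto
  then show ?thesis
  proof (rule Bochner_Integration.integrable_bound)
    show "(\<lambda>x. exp \<bar>s * (x i * x j - b)\<bar>) \<in> borel_measurable (gauss_row k)"
      using ij by measurable
    show "AE x in gauss_row k. norm (exp \<bar>s * (x i * x j - b)\<bar>) \<le> norm (exp (1 / 4) * (\<Prod>p<k. exp ((x p)\<^sup>2 / 4)))"
    proof (intro AE_I2)
      fix x :: "nat \<Rightarrow> real"
      have "2 * (\<bar>x i\<bar> * \<bar>x j\<bar>) \<le> (x i)\<^sup>2 + (x j)\<^sup>2"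
        using sum_squares_bound[of "\<bar>x i\<bar>" "\<bar>x j\<bar>"] by simp
      moreover have "(x p)\<^sup>2 \<le> (\<Sum>p<k. (x p)\<^sup>2)" if "p < k" for p
        using that by (intro member_le_sum) auto
      from this[of i] this[of j] have "(x i)\<^sup>2 + (x j)\<^sup>2 \<le> 2 * (\<Sum>p<k. (x p)\<^sup>2)"
        using ij by simp
      ultimately have "\<bar>x i * x j - b\<bar> \<le> 1 + (\<Sum>p<k. (x p)\<^sup>2)"
        using assms(4) by (simp add: abs_mult[symmetric])
      then have "\<bar>s * (x i * x j - b)\<bar> \<le> 1 / 4 + (\<Sum>p<k. (x p)\<^sup>2 / 4)"
        unfolding abs_mult assms(3) by (simp flip: sum_divide_distrib)
      then show "norm (exp \<bar>s * (x i * x j - b)\<bar>) \<le> norm (exp (1 / 4) * (\<Prod>p<k. exp ((x p)\<^sup>2 / 4)))"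
        by (simp flip: exp_sum exp_add)
    qed
  qed
qed

lemma gram_entry_tail:
  assumes ij: "i < k" "j < k" and "\<delta> > 0" "\<bar>\<sigma>\<bar> = 1"
  shows "\<exists>c>0. \<forall>N. emeasure (gauss_matrix N k) {H\<in>space (gauss_matrix N k).
      \<delta> * real N \<le> \<sigma> * ((\<Sum>l<N. H l i * H l j) - (if i = j then real N else 0))} \<le> ennreal (exp (- c * real N))"
proof -
  let ?b = "if i = j then 1 else (0::real)"
  let ?f = "\<lambda>x. \<sigma> / 4 * (x i * x j - ?b)"
  interpret row: prob_space "gauss_row k" by (rule prob_space_gauss_row)
  have "integrable (gauss_row k) ?f"
    using gauss_row_covariance(1)[OF ij] by auto
  moreover have "(\<integral>x. ?f x \<partial>gauss_row k) = 0"
    using gauss_row_covariance[OF ij] by (simp add: row.prob_space)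
  moreover have "integrable (gauss_row k) (\<lambda>x. exp \<bar>?f x\<bar>)"
    using assms by (intro gauss_row_exp_abs_integrable) auto
  ultimately obtain c where c: "c > 0" "\<And>N. emeasure (gauss_matrix N k) {H\<in>space (gauss_matrix N k). \<delta> / 4 * real N \<le> (\<Sum>l<N. ?f (H l))}
     \<le> ennreal (exp (- c * real N))"
    using cramer_upper_tail[OF prob_space_gauss_row, of k ?f "\<delta> / 4"] assms unfolding gauss_matrix_def by auto
  have "(\<Sum>l<N. ?f (H l)) = \<sigma> / 4 * ((\<Sum>l<N. H l i * H l j) - (if i = j then real N else 0))" for N and H :: "nat \<Rightarrow> nat \<Rightarrow> real"
    unfolding sum_distrib_left[symmetric] by (simp add: sum_subtractf)
  then have "(\<delta> / 4 * real N \<le> (\<Sum>l<N. ?f (H l))) \<longleftrightarrow> (\<delta> * real N \<le> \<sigma> * ((\<Sum>l<N. H l i * H l j) - (if i = j then real N else 0)))"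
    for N and H :: "nat \<Rightarrow> nat \<Rightarrow> real"
    by simp
  then show ?thesis using c by auto
qed

definition gram_close :: "nat \<Rightarrow> nat \<Rightarrow> real \<Rightarrow> (nat \<Rightarrow> nat \<Rightarrow> real) set" where
  "gram_close N k \<delta> = {H\<in>space (gauss_matrix N k).
     \<forall>i<k. \<forall>j<k. \<bar>(\<Sum>l<N. H l i * H l j) - (if i = j then real N else 0)\<bar> < \<delta> * real N}"

lemma gram_close_sets[measurable]: "gram_close N k \<delta> \<in> sets (gauss_matrix N k)"
proof -
  have "gram_close N k \<delta> = {H\<in>space (gauss_matrix N k).
     \<forall>i\<in>{..<k}. \<forall>j\<in>{..<k}. \<bar>(\<Sum>l<N. H l i * H l j) - (if i = j then real N else 0)\<bar> < \<delta> * real N}"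
    by (auto simp: gram_close_def)
  also have "\<dots> \<in> sets (gauss_matrix N k)" by measurable auto
  finally show ?thesis .
qed

text \<open>The exponential rate \<open>c N\<close> matters: it is negligible against probabilities of order
  \<open>exp (- const * N / \<beta>\<^sup>2)\<close>, because \<open>\<beta>\<close> tends to infinity.\<close>

lemma gram_close_probability:
  assumes "\<delta> > 0"
  shows "\<exists>c>0. \<forall>N. emeasure (gauss_matrix N k) (space (gauss_matrix N k) - gram_close N k \<delta>)
     \<le> ennreal (2 * (real k)\<^sup>2 * exp (- c * real N))"
proof -
  let ?T = "{..<k} \<times> {..<k} \<times> {1, -1::real}"
  define S where "S t N = (case t of (i, j, \<sigma>) \<Rightarrow> {H\<in>space (gauss_matrix N k).
      \<delta> * real N \<le> \<sigma> * ((\<Sum>l<N. H l i * H l j) - (if i = j then real N else 0))})" for t N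
  have "\<forall>t\<in>?T. \<exists>c>0. \<forall>N. emeasure (gauss_matrix N k) (S t N) \<le> ennreal (exp (- c * real N))"
  proof
    fix t assume "t \<in> ?T"
    then obtain i j \<sigma> where t: "t = (i, j, \<sigma>)" "i < k" "j < k" "\<bar>\<sigma>\<bar> = 1" by auto
    show "\<exists>c>0. \<forall>N. emeasure (gauss_matrix N k) (S t N) \<le> ennreal (exp (- c * real N))"
      using gram_entry_tail[OF t(2,3) assms t(4)] by (simp add: S_def t(1))
  qed
  then obtain c where c: "\<And>t. t \<in> ?T \<Longrightarrow> c t > 0"
    and ct: "\<And>t N. t \<in> ?T \<Longrightarrow> emeasure (gauss_matrix N k) (S t N) \<le> ennreal (exp (- c t * real N))"
    by (metis (no_types, lifting) bchoice)
  define d where "d = Min (insert 1 (c ` ?T))"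
  have d: "d > 0" "\<And>t. t \<in> ?T \<Longrightarrow> d \<le> c t"
    using c by (auto simp: d_def)
  have S[measurable]: "S t N \<in> sets (gauss_matrix N k)" if "t \<in> ?T" for t N
    using that unfolding S_def by auto
  show ?thesis
  proof (intro exI[of _ d] conjI allI d)
    fix N
    have "space (gauss_matrix N k) - gram_close N k \<delta> \<subseteq> (\<Union>t\<in>?T. S t N)"
    proof
      fix H assume "H \<in> space (gauss_matrix N k) - gram_close N k \<delta>"
      then obtain i j where H: "H \<in> space (gauss_matrix N k)" "i < k" "j < k"
        "\<delta> * real N \<le> \<bar>(\<Sum>l<N. H l i * H l j) - (if i = j then real N else 0)\<bar>"
        by (auto simp: gram_close_def not_less)
      then have "H \<in> S (i, j, 1) N \<or> H \<in> S (i, j, -1) N"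
        unfolding S_def by (auto simp: abs_if split: if_splits)
      then show "H \<in> (\<Union>t\<in>?T. S t N)" using H by blast
    qed
    then have "emeasure (gauss_matrix N k) (space (gauss_matrix N k) - gram_close N k \<delta>) \<le> emeasure (gauss_matrix N k) (\<Union>t\<in>?T. S t N)"
      by (intro emeasure_mono sets.finite_UN) auto
    also have "\<dots> \<le> (\<Sum>t\<in>?T. emeasure (gauss_matrix N k) (S t N))"
      by (intro emeasure_subadditive_finite) auto
    also have "\<dots> \<le> (\<Sum>t\<in>?T. ennreal (exp (- d * real N)))"
      by (intro sum_mono order_trans[OF ct] ennreal_leI) (use d in \<open>auto intro!: mult_right_mono\<close>)
    also have "\<dots> = ennreal (2 * (real k)\<^sup>2 * exp (- d * real N))"
      by (simp add: card_cartesian_product power2_eq_square ennreal_of_nat_eq_real_of_nat mult_ac flip: ennreal_mult')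
    finally show "emeasure (gauss_matrix N k) (space (gauss_matrix N k) - gram_close N k \<delta>) \<le> ennreal (2 * (real k)\<^sup>2 * exp (- d * real N))" .
  qed
qed

definition project :: "nat \<Rightarrow> ('m \<times> nat \<Rightarrow> real) \<Rightarrow> (nat \<Rightarrow> nat \<Rightarrow> real) \<Rightarrow> 'm \<times> nat \<Rightarrow> real" where
  "project N V H = (\<lambda>(i, j). \<Sum>n<N. V (i, n) * H n j)"

text \<open>The rows of \<open>V\<close> are orthonormal, so \<open>H \<mapsto> V H\<close> is a coisometry and preserves the moment generating
  function of a standard Gaussian matrix.\<close>

lemma gaussian_mgf_project:
  fixes V :: "'m::finite \<times> nat \<Rightarrow> real"
  assumes V: "V \<in> stiefel N"
  shows "gaussian_mgf (gauss_matrix N k) (UNIV \<times> {..<k}) (project N V)"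
proof -
  have row: "gaussian_mgf (gauss_row k) {..<k} (\<lambda>x. x)"
    unfolding gauss_row_def by (rule gaussian_mgf_PiM) simp
  have "(\<integral>\<^sup>+ H. ennreal (exp (\<Sum>p\<in>UNIV \<times> {..<k}. c p * project N V H p)) \<partial>gauss_matrix N k)
     = ennreal (exp (\<Sum>p\<in>UNIV \<times> {..<k}. (c p)\<^sup>2 / 2))" for c :: "'m \<times> nat \<Rightarrow> real"
  proof -
    define M where "M n j = (\<Sum>i\<in>UNIV. c (i, j) * V (i, n))" for n j
    have "(\<Sum>p\<in>UNIV \<times> {..<k}. c p * project N V H p) = (\<Sum>n<N. \<Sum>j<k. M n j * H n j)" for H
    proof -
      have "(\<Sum>p\<in>UNIV \<times> {..<k}. c p * project N V H p) = (\<Sum>i\<in>UNIV. \<Sum>j<k. \<Sum>n<N. c (i, j) * V (i, n) * H n j)"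
        unfolding sum.cartesian_product' by (simp add: project_def sum_distrib_left mult.assoc)
      also have "\<dots> = (\<Sum>i\<in>UNIV. \<Sum>n<N. \<Sum>j<k. c (i, j) * V (i, n) * H n j)"
        by (intro sum.cong refl sum.swap)
      also have "\<dots> = (\<Sum>n<N. \<Sum>i\<in>UNIV. \<Sum>j<k. c (i, j) * V (i, n) * H n j)"
        by (rule sum.swap)
      also have "\<dots> = (\<Sum>n<N. \<Sum>j<k. \<Sum>i\<in>UNIV. c (i, j) * V (i, n) * H n j)"
        by (intro sum.cong refl sum.swap)
      finally show ?thesis by (simp add: M_def sum_distrib_right)
    qed
    then have "(\<integral>\<^sup>+ H. ennreal (exp (\<Sum>p\<in>UNIV \<times> {..<k}. c p * project N V H p)) \<partial>gauss_matrix N k)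
      = (\<integral>\<^sup>+ H. ennreal (exp (\<Sum>n<N. \<Sum>j<k. M n j * H n j)) \<partial>gauss_matrix N k)" by simp
    also have "\<dots> = ennreal (exp (\<Sum>n<N. \<Sum>j<k. (M n j)\<^sup>2 / 2))"
      unfolding gauss_matrix_def
      using row by (intro nn_integral_PiM_exp_sum[where f = "\<lambda>n x. \<Sum>j<k. M n j * x j" and M = "\<lambda>_. gauss_row k"] prob_space_gauss_row)
         (auto simp: gaussian_mgf_def)
    also have "(\<Sum>n<N. \<Sum>j<k. (M n j)\<^sup>2 / 2) = (\<Sum>p\<in>UNIV \<times> {..<k}. (c p)\<^sup>2 / 2)"
    proof -
      have "(\<Sum>n<N. (M n j)\<^sup>2) = (\<Sum>i\<in>UNIV. (c (i, j))\<^sup>2)" for j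
      proof -
        have "(\<Sum>n<N. (M n j)\<^sup>2) = (\<Sum>n<N. \<Sum>i\<in>UNIV. \<Sum>l\<in>UNIV. c (i, j) * c (l, j) * (V (i, n) * V (l, n)))"
          by (simp add: M_def power2_eq_square sum_product mult_ac)
        also have "\<dots> = (\<Sum>i\<in>UNIV. \<Sum>l\<in>UNIV. \<Sum>n<N. c (i, j) * c (l, j) * (V (i, n) * V (l, n)))"
          by (rule trans[OF sum.swap], rule sum.cong[OF refl], rule sum.swap)
        also have "\<dots> = (\<Sum>i\<in>UNIV. \<Sum>l\<in>UNIV. c (i, j) * c (l, j) * (if i = l then 1 else 0))"
          using V by (simp add: stiefel_def flip: sum_distrib_left)
        also have "\<dots> = (\<Sum>i\<in>UNIV. (c (i, j))\<^sup>2)"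
          by (simp add: if_distrib power2_eq_square cong: if_cong)
        finally show ?thesis .
      qed
      then have "(\<Sum>j<k. \<Sum>n<N. (M n j)\<^sup>2) = (\<Sum>j<k. \<Sum>i\<in>UNIV. (c (i, j))\<^sup>2)" by simp
      then have "(\<Sum>n<N. \<Sum>j<k. (M n j)\<^sup>2) = (\<Sum>i\<in>UNIV. \<Sum>j<k. (c (i, j))\<^sup>2)"
        by (simp add: sum.swap[of _ _ "{..<k}"])
      also have "\<dots> = (\<Sum>p\<in>UNIV \<times> {..<k}. (c p)\<^sup>2)"
        by (simp add: sum.cartesian_product)
      finally show ?thesis by (simp flip: sum_divide_distrib)
    qed
    finally show ?thesis .
  qed
  moreover have "(\<lambda>H. project N V H p) \<in> borel_measurable (gauss_matrix N k)" if "p \<in> UNIV \<times> {..<k}" for p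
    using that by (cases p) (auto simp: project_def)
  ultimately show ?thesis
    using prob_space_gauss_matrix by (simp add: gaussian_mgf_def)
qed

section \<open>From Gaussian to Haar matrices\<close>

abbreviation rotate_columns :: "nat \<Rightarrow> (nat \<Rightarrow> nat \<Rightarrow> real) \<Rightarrow> ('m::finite \<times> nat \<Rightarrow> real) \<Rightarrow> 'm \<times> nat \<Rightarrow> real" where
  "rotate_columns N B \<equiv> two_sided_mult N (mat 1) (\<lambda>i j. B j i)"

lemma rotate_columns_eq:
  assumes "l < N"
  shows "rotate_columns N B V (i, l) = mat_vec N B (\<lambda>n. V (i, n)) l"
proof -
  have "rotate_columns N B V (i, l) = (\<Sum>k\<in>UNIV. \<Sum>n<N. mat 1 $ i $ k * V (k, n) * B l n)"
    using assms by (simp add: two_sided_mult_def)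
  also have "\<dots> = (\<Sum>k\<in>UNIV. if i = k then \<Sum>n<N. V (k, n) * B l n else 0)"
    by (intro sum.cong refl) (simp add: mat_def)
  finally show ?thesis by (simp add: mat_vec_def mult.commute)
qed

lemma distr_rotate_columns:
  fixes \<mu> :: "('m::finite \<times> nat \<Rightarrow> real) measure"
  assumes "stiefel_haar N \<mu>" "B \<in> orthogonal_group N"
  shows "distr \<mu> (stiefel_borel N) (rotate_columns N B) = \<mu>"
  using assms orthogonal_group_transpose[OF assms(2)] by (simp add: stiefel_haar_def orthogonal_matrix_id)

lemma emeasure_rotate_columns:
  fixes \<mu> :: "('m::finite \<times> nat \<Rightarrow> real) measure"
  assumes \<mu>: "stiefel_haar N \<mu>" and B: "B \<in> orthogonal_group N" and S: "{V\<in>space \<mu>. P V} \<in> sets \<mu>"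
  shows "emeasure \<mu> {V\<in>space \<mu>. P (rotate_columns N B V)} = emeasure \<mu> {V\<in>space \<mu>. P V}"
    and "{V\<in>space \<mu>. P (rotate_columns N B V)} \<in> sets \<mu>"
proof -
  have sets: "sets \<mu> = sets (stiefel_borel N)" using \<mu> by (simp add: stiefel_haar_def)
  then have space: "space \<mu> = space (stiefel_borel N)" by (rule sets_eq_imp_space_eq)
  have m: "rotate_columns N B \<in> \<mu> \<rightarrow>\<^sub>M stiefel_borel N"
    using two_sided_mult_measurable[OF orthogonal_matrix_id orthogonal_group_transpose[OF B]]
      measurable_cong_sets[OF sets refl] by blast
  have eq: "rotate_columns N B -` {V\<in>space \<mu>. P V} \<inter> space \<mu> = {V\<in>space \<mu>. P (rotate_columns N B V)}"
    using measurable_space[OF m] space by auto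
  have S': "{V\<in>space \<mu>. P V} \<in> sets (stiefel_borel N)" using S sets by simp
  show "{V\<in>space \<mu>. P (rotate_columns N B V)} \<in> sets \<mu>"
    using measurable_sets[OF m S'] unfolding eq .
  show "emeasure \<mu> {V\<in>space \<mu>. P (rotate_columns N B V)} = emeasure \<mu> {V\<in>space \<mu>. P V}"
    using emeasure_distr[OF m S'] unfolding eq distr_rotate_columns[OF \<mu> B] by simp
qed

lemma project_rotate:
  assumes B: "B \<in> orthogonal_group N"
  shows "project N V H (i, j) = (\<Sum>l<N. rotate_columns N B V (i, l) * mat_vec N B (\<lambda>n. H n j) l)"
  using orthogonal_group_inner[OF B, of "\<lambda>n. V (i, n)" "\<lambda>n. H n j"] by (simp add: project_def rotate_columns_eq)

lemma abs_le_L2_set: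
  assumes "finite A" "p \<in> A"
  shows "\<bar>f p\<bar> \<le> L2_set f A"
  using member_le_L2_set[OF assms, of "\<lambda>p. \<bar>f p\<bar>"] by (simp add: L2_set_def)

text \<open>If the columns of \<open>H / sqrt N\<close> are almost orthonormal, some rotation \<open>B\<close> maps them almost onto the
  first \<open>k\<close> unit vectors. As \<open>V H = (V B\<^sup>T) (B H)\<close>, the matrix \<open>V H / sqrt N\<close> is then close to the
  first \<open>k\<close> columns of \<open>V B\<^sup>T\<close>. The rotation depends on \<open>H\<close> alone, hence \<open>V B\<^sup>T\<close> has the law of \<open>V\<close>.\<close>

lemma gram_close_comparison:
  assumes "\<kappa> > 0"
  shows "\<exists>\<delta>>0. \<forall>N\<ge>k. N > 0 \<longrightarrow> (\<forall>H\<in>gram_close N k \<delta>. \<exists>B\<in>orthogonal_group N. \<forall>V::'m::finite \<times> nat \<Rightarrow> real.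
     L2_set (\<lambda>p. project N V H p / sqrt (real N) - rotate_columns N B V p) (UNIV \<times> {..<k})
       \<le> \<kappa> * L2_set (rotate_columns N B V) (UNIV \<times> {..<k}))"
proof -
  let ?J = "(UNIV :: 'm set) \<times> {..<k}"
  define q where "q = real (card ?J) * real k"
  define \<epsilon> where "\<epsilon> = \<kappa> / (q + 1)"
  have q: "0 \<le> q" by (simp add: q_def)
  have \<epsilon>: "\<epsilon> > 0" "q * \<epsilon> \<le> \<kappa>"
    using assms q by (auto simp: \<epsilon>_def field_simps)
  obtain \<delta> where \<delta>: "\<delta> > 0" and rot: "\<forall>N\<ge>k. \<forall>h::nat \<Rightarrow> nat \<Rightarrow> real.
     (\<forall>i<k. \<forall>j<k. \<bar>(\<Sum>l<N. h i l * h j l) - (if i = j then 1 else 0)\<bar> \<le> \<delta>) \<longrightarrow>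
     (\<exists>B\<in>orthogonal_group N. \<forall>j<k. (\<forall>l<N. k \<le> l \<longrightarrow> mat_vec N B (h j) l = 0) \<and>
        (\<forall>l<k. \<bar>mat_vec N B (h j) l - (if l = j then 1 else 0)\<bar> \<le> \<epsilon>))"
    using near_orthonormal_rotation[OF \<epsilon>(1), of k] by (elim exE conjE)
  show ?thesis
  proof (intro exI[of _ \<delta>] conjI \<delta> allI impI ballI)
    fix N H assume N: "k \<le> N" "0 < N" and H: "H \<in> gram_close N k \<delta>"
    define h where "h j l = H l j / sqrt (real N)" for j l
    have "\<bar>(\<Sum>l<N. h i l * h j l) - (if i = j then 1 else 0)\<bar> \<le> \<delta>" if "i < k" "j < k" for i j
    proof -
      have "(\<Sum>l<N. h i l * h j l) - (if i = j then 1 else 0) = ((\<Sum>l<N. H l i * H l j) - (if i = j then real N else 0)) / real N"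
        using N by (simp add: h_def diff_divide_distrib flip: sum_divide_distrib)
      moreover have "\<bar>(\<Sum>l<N. H l i * H l j) - (if i = j then real N else 0)\<bar> < \<delta> * real N"
        using H that by (simp add: gram_close_def)
      ultimately show ?thesis
        using N by (simp add: abs_divide pos_divide_le_eq)
    qed
    then obtain B where B: "B \<in> orthogonal_group N"
      and B0: "\<And>j l. j < k \<Longrightarrow> l < N \<Longrightarrow> k \<le> l \<Longrightarrow> mat_vec N B (h j) l = 0"
      and B1: "\<And>j l. j < k \<Longrightarrow> l < k \<Longrightarrow> \<bar>mat_vec N B (h j) l - (if l = j then 1 else 0)\<bar> \<le> \<epsilon>"
      using rot[rule_format, of N h] N by auto
    show "\<exists>B\<in>orthogonal_group N. \<forall>V::'m \<times> nat \<Rightarrow> real.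
     L2_set (\<lambda>p. project N V H p / sqrt (real N) - rotate_columns N B V p) ?J
       \<le> \<kappa> * L2_set (rotate_columns N B V) ?J"
    proof (intro bexI[of _ B] B allI)
      fix V :: "'m \<times> nat \<Rightarrow> real"
      let ?W = "rotate_columns N B V"
      let ?d = "\<lambda>p. project N V H p / sqrt (real N) - ?W p"
      have d: "\<bar>?d p\<bar> \<le> real k * (\<epsilon> * L2_set ?W ?J)" if p: "p \<in> ?J" for p
      proof -
        obtain i j where ij: "p = (i, j)" "j < k" using p by auto
        have "mat_vec N B (\<lambda>n. H n j) l / sqrt (real N) = mat_vec N B (h j) l" for l
          by (simp add: mat_vec_def h_def sum_divide_distrib)
        then have "project N V H p / sqrt (real N) = (\<Sum>l<N. ?W (i, l) * mat_vec N B (h j) l)"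
          unfolding ij project_rotate[OF B] by (simp add: sum_divide_distrib times_divide_eq_right flip: times_divide_eq_right)
        also have "\<dots> = (\<Sum>l<k. ?W (i, l) * mat_vec N B (h j) l)"
          using N B0[OF ij(2)] by (intro sum.mono_neutral_right) auto
        moreover have "(\<Sum>l<k. ?W (i, l) * (if l = j then 1 else 0)) = ?W p"
          using ij by (simp add: if_distrib cong: if_cong)
        ultimately have "?d p = (\<Sum>l<k. ?W (i, l) * (mat_vec N B (h j) l - (if l = j then 1 else 0)))"
          by (simp add: right_diff_distrib sum_subtractf)
        also have "\<bar>\<dots>\<bar> \<le> (\<Sum>l<k. \<epsilon> * L2_set ?W ?J)"
        proof (rule order_trans[OF sum_abs sum_mono])
          fix l assume l: "l \<in> {..<k}"
          have "\<bar>?W (i, l)\<bar> \<le> L2_set ?W ?J"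
            using l by (intro abs_le_L2_set) auto
          then show "\<bar>?W (i, l) * (mat_vec N B (h j) l - (if l = j then 1 else 0))\<bar> \<le> \<epsilon> * L2_set ?W ?J"
            using B1[OF ij(2), of l] l unfolding abs_mult by (subst mult.commute) (intro mult_mono; simp)
        qed
        finally show ?thesis by simp
      qed
      have "L2_set ?d ?J \<le> (\<Sum>p\<in>?J. \<bar>?d p\<bar>)"
        by (rule L2_set_le_sum_abs)
      also have "\<dots> \<le> (\<Sum>p\<in>?J. real k * (\<epsilon> * L2_set ?W ?J))"
        by (intro sum_mono d)
      also have "\<dots> = (q * \<epsilon>) * L2_set ?W ?J"
        by (simp add: q_def)
      also have "\<dots> \<le> \<kappa> * L2_set ?W ?J"
        using \<epsilon> by (intro mult_right_mono) (auto simp: L2_set_nonneg)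
      finally show "L2_set ?d ?J \<le> \<kappa> * L2_set ?W ?J" .
    qed
  qed
qed

context
  fixes N :: nat and \<mu> :: "('m::finite \<times> nat \<Rightarrow> real) measure"
  assumes \<mu>: "stiefel_haar N \<mu>"
begin

lemma haar_space: "space \<mu> = stiefel N"
proof -
  have "space \<mu> = space (stiefel_borel N)" using \<mu> by (intro sets_eq_imp_space_eq) (simp add: stiefel_haar_def)
  then show ?thesis by (auto simp: stiefel_borel_def space_restrict_space space_PiM stiefel_def)
qed

lemma haar_entry_measurable: "n < N \<Longrightarrow> (\<lambda>V. V (i, n)) \<in> borel_measurable \<mu>"
proof -
  assume "n < N"
  then have "(\<lambda>V. V (i, n)) \<in> borel_measurable (stiefel_borel N)"
    unfolding stiefel_borel_def by (intro measurable_restrict_space1 measurable_component_singleton) auto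
  then show ?thesis
    using \<mu> measurable_cong_sets[OF _ refl, of \<mu> "stiefel_borel N" borel] by (auto simp: stiefel_haar_def)
qed

lemma project_measurable:
  assumes "p \<in> UNIV \<times> {..<k}"
  shows "(\<lambda>(V, H). project N V H p) \<in> borel_measurable (\<mu> \<Otimes>\<^sub>M gauss_matrix N k)"
proof -
  obtain i j where p: "p = (i, j)" "j < k" using assms by auto
  show ?thesis
    unfolding p project_def case_prod_beta fst_conv snd_conv
    using p(2) by (intro borel_measurable_sum borel_measurable_times measurable_compose[OF measurable_fst]
      measurable_compose[OF measurable_snd] haar_entry_measurable measurable_gauss_matrix) auto
qed

lemma haar_gauss_pair: "pair_sigma_finite \<mu> (gauss_matrix N k)"
proof -
  interpret prob_space \<mu> using \<mu> by (simp add: stiefel_haar_def)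
  interpret g: prob_space "gauss_matrix N k" by (rule prob_space_gauss_matrix)
  show ?thesis ..
qed

text \<open>The integral of \<open>exp (a / 2 \<parallel>V H\<parallel>\<^sup>2)\<close> over \<open>V\<close> and \<open>H\<close> is computed in two ways. With \<open>V\<close> fixed it is a
  Gaussian integral that does not depend on \<open>N\<close>. With \<open>H\<close> in \<open>E\<close> fixed, \<open>V H\<close> is comparable to \<open>sqrt N\<close>
  times the first \<open>k\<close> columns of a rotated copy of \<open>V\<close>, and Markov's inequality applies.\<close>

lemma haar_norm_tail:
  assumes "0 \<le> a" "a < 1" "0 \<le> \<kappa>" "\<kappa> < 1" "0 < N" "0 \<le> r"
    and E: "E \<in> sets (gauss_matrix N k)"
    and cmp: "\<And>H. H \<in> E \<Longrightarrow> \<exists>B\<in>orthogonal_group N. \<forall>V::'m \<times> nat \<Rightarrow> real.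
       L2_set (\<lambda>p. project N V H p / sqrt (real N) - rotate_columns N B V p) (UNIV \<times> {..<k})
       \<le> \<kappa> * L2_set (rotate_columns N B V) (UNIV \<times> {..<k})"
    and S: "{V\<in>space \<mu>. r \<le> L2_set V (UNIV \<times> {..<k})} \<in> sets \<mu>"
  shows "ennreal (exp (a / 2 * (real N * ((1 - \<kappa>) * r)\<^sup>2))) * emeasure \<mu> {V\<in>space \<mu>. r \<le> L2_set V (UNIV \<times> {..<k})} * emeasure (gauss_matrix N k) E
     \<le> ennreal ((1 / sqrt (1 - a)) ^ (CARD('m) * k))"
proof -
  let ?J = "(UNIV :: 'm set) \<times> {..<k}"
  let ?G = "gauss_matrix N k"
  let ?S = "{V\<in>space \<mu>. r \<le> L2_set V ?J}"
  let ?c = "exp (a / 2 * (real N * ((1 - \<kappa>) * r)\<^sup>2))"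
  let ?g = "\<lambda>V H. ennreal (exp (a / 2 * (\<Sum>p\<in>?J. (project N V H p)\<^sup>2)))"
  interpret pr: pair_sigma_finite \<mu> ?G by (rule haar_gauss_pair)
  interpret mu: prob_space \<mu> using \<mu> by (simp add: stiefel_haar_def)
  have meas: "case_prod ?g \<in> borel_measurable (\<mu> \<Otimes>\<^sub>M ?G)"
  proof -
    note project_measurable[unfolded case_prod_beta, measurable]
    show ?thesis unfolding case_prod_beta by measurable
  qed
  have inner: "ennreal ?c * emeasure \<mu> ?S \<le> (\<integral>\<^sup>+ V. ?g V H \<partial>\<mu>)" if H: "H \<in> E" for H
  proof -
    obtain B where B: "B \<in> orthogonal_group N" and
      cmpB: "\<And>V::'m \<times> nat \<Rightarrow> real. L2_set (\<lambda>p. project N V H p / sqrt (real N) - rotate_columns N B V p) ?J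
         \<le> \<kappa> * L2_set (rotate_columns N B V) ?J"
      using cmp[OF H] by auto
    let ?T = "{V\<in>space \<mu>. r \<le> L2_set (rotate_columns N B V) ?J}"
    have T: "?T \<in> sets \<mu>" "emeasure \<mu> ?T = emeasure \<mu> ?S"
      using emeasure_rotate_columns[OF \<mu> B S] by auto
    have "ennreal ?c * emeasure \<mu> ?S = (\<integral>\<^sup>+ V. ennreal ?c * indicator ?T V \<partial>\<mu>)"
      using T by (simp add: nn_integral_cmult_indicator)
    also have "\<dots> \<le> (\<integral>\<^sup>+ V. ?g V H \<partial>\<mu>)"
    proof (intro nn_integral_mono)
      fix V
      show "ennreal ?c * indicator ?T V \<le> ?g V H"
      proof (cases "V \<in> ?T")
        case True
        let ?W = "rotate_columns N B V" and ?Y = "\<lambda>p. project N V H p / sqrt (real N)"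
        have "L2_set ?W ?J = L2_set (\<lambda>p. ?Y p + - (?Y p - ?W p)) ?J" by simp
        also have "\<dots> \<le> L2_set ?Y ?J + L2_set (\<lambda>p. - (?Y p - ?W p)) ?J"
          by (rule L2_set_triangle_ineq)
        also have "L2_set (\<lambda>p. - (?Y p - ?W p)) ?J = L2_set (\<lambda>p. ?Y p - ?W p) ?J"
          by (simp add: L2_set_def power2_commute)
        finally have "(1 - \<kappa>) * L2_set ?W ?J \<le> L2_set ?Y ?J"
          using cmpB[of V] by (simp add: algebra_simps)
        moreover have "(1 - \<kappa>) * r \<le> (1 - \<kappa>) * L2_set ?W ?J"
          using True assms by (intro mult_left_mono) auto
        ultimately have "(1 - \<kappa>) * r \<le> L2_set ?Y ?J" by linarith
        then have "((1 - \<kappa>) * r)\<^sup>2 \<le> (L2_set ?Y ?J)\<^sup>2"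
          using assms by (intro power_mono) auto
        also have "\<dots> = (\<Sum>p\<in>?J. (project N V H p)\<^sup>2) / real N"
          using assms by (simp add: L2_set_def sum_nonneg power_divide sum_divide_distrib)
        finally have "real N * ((1 - \<kappa>) * r)\<^sup>2 \<le> (\<Sum>p\<in>?J. (project N V H p)\<^sup>2)"
          using assms by (simp add: field_simps)
        then show ?thesis using True assms by (auto intro!: ennreal_leI mult_left_mono)
      qed simp
    qed
    finally show ?thesis .
  qed
  have "ennreal ?c * emeasure \<mu> ?S * emeasure ?G E = (\<integral>\<^sup>+ H. ennreal ?c * emeasure \<mu> ?S * indicator E H \<partial>?G)"
    using E by (simp add: nn_integral_cmult_indicator)
  also have "\<dots> \<le> (\<integral>\<^sup>+ H. \<integral>\<^sup>+ V. ?g V H \<partial>\<mu> \<partial>?G)"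
    using inner by (intro nn_integral_mono) (auto simp: indicator_def)
  also have "\<dots> = (\<integral>\<^sup>+ V. \<integral>\<^sup>+ H. ?g V H \<partial>?G \<partial>\<mu>)"
    by (rule pr.Fubini'[OF meas])
  also have "\<dots> = (\<integral>\<^sup>+ V. ennreal ((1 / sqrt (1 - a)) ^ card ?J) \<partial>\<mu>)"
    using assms haar_space by (intro nn_integral_cong gaussian_mgf_exp_square gaussian_mgf_project) auto
  also have "\<dots> = ennreal ((1 / sqrt (1 - a)) ^ (CARD('m) * k))"
    by (simp add: mu.emeasure_space_1 card_cartesian_product)
  finally show ?thesis .
qed

lemma haar_norm_sets: "k \<le> N \<Longrightarrow> {V\<in>space \<mu>. r \<le> L2_set V (UNIV \<times> {..<k})} \<in> sets \<mu>"
proof -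
  assume k: "k \<le> N"
  have "(\<lambda>V. V p) \<in> borel_measurable \<mu>" if "p \<in> UNIV \<times> {..<k}" for p
    using that k haar_entry_measurable by (cases p) auto
  then show ?thesis
    unfolding L2_set_def by measurable
qed

lemma haar_box_sets: "k \<le> N \<Longrightarrow> {V\<in>space \<mu>. \<forall>p\<in>UNIV \<times> {..<k}. \<bar>V p - a p\<bar> < e} \<in> sets \<mu>"
proof -
  assume k: "k \<le> N"
  have "(\<lambda>V. V p) \<in> borel_measurable \<mu>" if "p \<in> UNIV \<times> {..<k}" for p
    using that k haar_entry_measurable by (cases p) auto
  then show ?thesis
    by measurable
qed

text \<open>The same exchange of integrals for the event that \<open>V H / sqrt N\<close> lies in a box around \<open>b a\<close>. With \<open>V\<close>
  fixed its probability is bounded below by \<open>gaussian_mgf_box_lower\<close>; with \<open>H\<close> in \<open>E\<close> fixed it forces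
  the first \<open>k\<close> columns of the rotated \<open>V\<close> into a slightly larger box, the enlargement being
  proportional to \<open>b\<close>.\<close>

lemma haar_box_lower:
  fixes a :: "'m \<times> nat \<Rightarrow> real" and k :: nat
  defines "J \<equiv> (UNIV :: 'm set) \<times> {..<k}"
  assumes "0 < e" "0 < \<kappa>" "\<kappa> \<le> 1 / 2" "0 < N" "k \<le> N" "0 < b"
    and \<epsilon>: "e + 2 * \<kappa> * (\<Sum>p\<in>J. \<bar>a p\<bar> + e) \<le> \<epsilon>"
    and E: "E \<in> sets (gauss_matrix N k)"
    and cmp: "\<And>H. H \<in> E \<Longrightarrow> \<exists>B\<in>orthogonal_group N. \<forall>V::'m \<times> nat \<Rightarrow> real.
       L2_set (\<lambda>p. project N V H p / sqrt (real N) - rotate_columns N B V p) J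
       \<le> \<kappa> * L2_set (rotate_columns N B V) J"
  shows "ennreal (exp (- (real N * b\<^sup>2) * ((\<Sum>p\<in>J. (a p)\<^sup>2) / 2 + e * (\<Sum>p\<in>J. \<bar>a p\<bar>))) * (1 - 2 * card J * exp (- e\<^sup>2 * (real N * b\<^sup>2) / 2)))
    \<le> emeasure \<mu> {V\<in>space \<mu>. \<forall>p\<in>J. \<bar>V p - b * a p\<bar> < \<epsilon> * b} + emeasure (gauss_matrix N k) (space (gauss_matrix N k) - E)"
    (is "ennreal ?l \<le> emeasure \<mu> ?S + _")
proof -
  let ?G = "gauss_matrix N k"
  let ?P = "\<lambda>V H. \<forall>p\<in>J. \<bar>project N V H p - (sqrt (real N) * b) * a p\<bar> < e * (sqrt (real N) * b)"
  let ?i = "\<lambda>V H. indicator {(V, H). ?P V H} (V, H) :: ennreal"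
  interpret pr: pair_sigma_finite \<mu> ?G by (rule haar_gauss_pair)
  interpret mu: prob_space \<mu> using \<mu> by (simp add: stiefel_haar_def)
  interpret g: prob_space ?G by (rule prob_space_gauss_matrix)
  have J: "finite J" by (simp add: J_def)
  have Pm: "{z\<in>space (\<mu> \<Otimes>\<^sub>M ?G). ?P (fst z) (snd z)} \<in> sets (\<mu> \<Otimes>\<^sub>M ?G)"
  proof -
    have "(\<lambda>z. project N (fst z) (snd z) p) \<in> borel_measurable (\<mu> \<Otimes>\<^sub>M ?G)" if "p \<in> J" for p
      using project_measurable that unfolding J_def case_prod_beta by blast
    then show ?thesis
      using J by measurable
  qed
  have meas: "case_prod ?i \<in> borel_measurable (\<mu> \<Otimes>\<^sub>M ?G)"
  proof (subst measurable_cong)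
    show "case_prod ?i z = indicator {z\<in>space (\<mu> \<Otimes>\<^sub>M ?G). ?P (fst z) (snd z)} z" if "z \<in> space (\<mu> \<Otimes>\<^sub>M ?G)" for z
      using that by (simp add: indicator_def case_prod_beta)
    show "indicator {z\<in>space (\<mu> \<Otimes>\<^sub>M ?G). ?P (fst z) (snd z)} \<in> borel_measurable (\<mu> \<Otimes>\<^sub>M ?G)"
      using Pm by (rule borel_measurable_indicator)
  qed
  have lower: "ennreal ?l \<le> (\<integral>\<^sup>+ H. ?i V H \<partial>?G)" if V: "V \<in> space \<mu>" for V
  proof -
    have mgf: "gaussian_mgf ?G J (project N V)"
      using V haar_space unfolding J_def by (intro gaussian_mgf_project) auto
    have "ennreal ?l \<le> emeasure ?G {H\<in>space ?G. ?P V H}"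
      using gaussian_mgf_box_lower[OF mgf assms(2), of "sqrt (real N) * b" a] assms
      by (simp add: power_mult_distrib mult_ac)
    also have "\<dots> = (\<integral>\<^sup>+ H. indicator {H\<in>space ?G. ?P V H} H \<partial>?G)"
    proof (subst nn_integral_indicator)
      have "(\<lambda>H. project N V H p) \<in> borel_measurable ?G" if "p \<in> J" for p
        using mgf that by (auto simp: gaussian_mgf_def)
      then show "{H\<in>space ?G. ?P V H} \<in> sets ?G" using J by measurable
    qed simp
    also have "\<dots> = (\<integral>\<^sup>+ H. ?i V H \<partial>?G)"
      by (intro nn_integral_cong) (auto simp: indicator_def)
    finally show ?thesis .
  qed
  have S: "?S \<in> sets \<mu>"
    unfolding J_def using assms by (intro haar_box_sets)
  have inner: "(\<integral>\<^sup>+ V. ?i V H \<partial>\<mu>) \<le> emeasure \<mu> ?S" if H: "H \<in> E" for H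
  proof -
    obtain B where B: "B \<in> orthogonal_group N" and
      cmpB: "\<And>V::'m \<times> nat \<Rightarrow> real. L2_set (\<lambda>p. project N V H p / sqrt (real N) - rotate_columns N B V p) J
         \<le> \<kappa> * L2_set (rotate_columns N B V) J"
      using cmp[OF H] by auto
    let ?T = "{V\<in>space \<mu>. \<forall>p\<in>J. \<bar>rotate_columns N B V p - b * a p\<bar> < \<epsilon> * b}"
    have T: "?T \<in> sets \<mu>" "emeasure \<mu> ?T = emeasure \<mu> ?S"
      using emeasure_rotate_columns[OF \<mu> B S] by auto
    have "(\<integral>\<^sup>+ V. ?i V H \<partial>\<mu>) \<le> (\<integral>\<^sup>+ V. indicator ?T V \<partial>\<mu>)"
    proof (intro nn_integral_mono)
      fix V assume V: "V \<in> space \<mu>"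
      show "?i V H \<le> indicator ?T V"
      proof (cases "?P V H")
        case True
        let ?W = "rotate_columns N B V" and ?Y = "\<lambda>p. project N V H p / sqrt (real N)"
        have Y: "\<bar>?Y p - b * a p\<bar> < e * b" if "p \<in> J" for p
        proof -
          have "\<bar>?Y p - b * a p\<bar> = \<bar>(project N V H p - (sqrt (real N) * b) * a p) / sqrt (real N)\<bar>"
            using assms by (simp add: field_simps)
          also have "\<dots> = \<bar>project N V H p - (sqrt (real N) * b) * a p\<bar> / sqrt (real N)"
            by (simp add: abs_divide)
          also have "\<dots> < e * (sqrt (real N) * b) / sqrt (real N)"
            using True that assms by (intro divide_strict_right_mono) auto
          finally show ?thesis using assms by simp
        qed
        have "L2_set ?Y J \<le> (\<Sum>p\<in>J. \<bar>?Y p\<bar>)" by (rule L2_set_le_sum_abs)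
        also have "\<dots> \<le> (\<Sum>p\<in>J. b * (\<bar>a p\<bar> + e))"
        proof (intro sum_mono)
          fix p assume "p \<in> J"
          from Y[OF this] have "\<bar>?Y p\<bar> \<le> \<bar>b * a p\<bar> + e * b" by linarith
          then show "\<bar>?Y p\<bar> \<le> b * (\<bar>a p\<bar> + e)" using assms by (simp add: abs_mult algebra_simps)
        qed
        finally have Yn: "L2_set ?Y J \<le> b * (\<Sum>p\<in>J. \<bar>a p\<bar> + e)"
          by (simp add: sum_distrib_left)
        have "L2_set ?W J = L2_set (\<lambda>p. ?Y p + - (?Y p - ?W p)) J" by simp
        also have "\<dots> \<le> L2_set ?Y J + L2_set (\<lambda>p. - (?Y p - ?W p)) J"
          by (rule L2_set_triangle_ineq)
        also have "L2_set (\<lambda>p. - (?Y p - ?W p)) J = L2_set (\<lambda>p. ?Y p - ?W p) J"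
          by (simp add: L2_set_def power2_commute)
        finally have "L2_set ?W J \<le> L2_set ?Y J + \<kappa> * L2_set ?W J"
          using cmpB[of V] by simp
        moreover have "\<kappa> * L2_set ?W J \<le> 1 / 2 * L2_set ?W J"
          using assms by (intro mult_right_mono) (auto simp: L2_set_nonneg)
        ultimately have Wn: "L2_set ?W J \<le> 2 * (b * (\<Sum>p\<in>J. \<bar>a p\<bar> + e))"
          using Yn by simp
        have "\<bar>?W p - b * a p\<bar> < \<epsilon> * b" if p: "p \<in> J" for p
        proof -
          have "\<bar>?Y p - ?W p\<bar> \<le> L2_set (\<lambda>p. ?Y p - ?W p) J"
            using abs_le_L2_set[OF J p, of "\<lambda>p. ?Y p - ?W p"] .
          also have "\<dots> \<le> \<kappa> * L2_set ?W J" by (rule cmpB)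
          also have "\<dots> \<le> \<kappa> * (2 * (b * (\<Sum>p\<in>J. \<bar>a p\<bar> + e)))"
            using Wn assms by (intro mult_left_mono) auto
          finally have "\<bar>?W p - b * a p\<bar> < e * b + \<kappa> * (2 * (b * (\<Sum>p\<in>J. \<bar>a p\<bar> + e)))"
            using Y[OF p] by linarith
          also have "\<dots> = (e + 2 * \<kappa> * (\<Sum>p\<in>J. \<bar>a p\<bar> + e)) * b" by (simp add: algebra_simps)
          also have "\<dots> \<le> \<epsilon> * b" using \<epsilon> assms by (intro mult_right_mono) auto
          finally show ?thesis .
        qed
        then show ?thesis using V by (simp add: indicator_def)
      next
        case False
        then show ?thesis by (simp add: indicator_def) blast
      qed
    qed
    also have "\<dots> = emeasure \<mu> ?S" using T by simp
    finally show ?thesis .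
  qed
  have "ennreal ?l = (\<integral>\<^sup>+ V. ennreal ?l \<partial>\<mu>)"
    by (simp add: mu.emeasure_space_1)
  also have "\<dots> \<le> (\<integral>\<^sup>+ V. \<integral>\<^sup>+ H. ?i V H \<partial>?G \<partial>\<mu>)"
    by (intro nn_integral_mono lower)
  also have "\<dots> = (\<integral>\<^sup>+ H. \<integral>\<^sup>+ V. ?i V H \<partial>\<mu> \<partial>?G)"
    by (rule pr.Fubini'[OF meas, symmetric])
  also have "\<dots> \<le> (\<integral>\<^sup>+ H. emeasure \<mu> ?S + indicator (space ?G - E) H \<partial>?G)"
  proof (intro nn_integral_mono)
    fix H assume H: "H \<in> space ?G"
    show "(\<integral>\<^sup>+ V. ?i V H \<partial>\<mu>) \<le> emeasure \<mu> ?S + indicator (space ?G - E) H"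
    proof (cases "H \<in> E")
      case True
      then show ?thesis using inner by (auto intro: add_increasing2)
    next
      case False
      have "(\<integral>\<^sup>+ V. ?i V H \<partial>\<mu>) \<le> (\<integral>\<^sup>+ V. 1 \<partial>\<mu>)"
        by (intro nn_integral_mono) (auto simp: indicator_def)
      also have "\<dots> = 1" by (simp add: mu.emeasure_space_1)
      finally show ?thesis using False H by (auto intro: add_increasing)
    qed
  qed
  also have "\<dots> = emeasure \<mu> ?S + emeasure ?G (space ?G - E)"
    using E by (subst nn_integral_add) (auto simp: g.emeasure_space_1)
  finally show ?thesis .
qed

end

section \<open>The rate function and the product topology\<close>

definition column_sq :: "nat \<Rightarrow> ('m::finite \<times> nat \<Rightarrow> real) \<Rightarrow> real" where
  "column_sq k A = (\<Sum>p\<in>UNIV \<times> {..<k}. (A p)\<^sup>2)"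

lemma column_sq_nonneg: "0 \<le> column_sq k A"
  by (simp add: column_sq_def sum_nonneg)

lemma frobenius_rate_eq_SUP: "frobenius_sq A / 2 = (SUP k. ennreal (column_sq k A / 2))"
proof -
  have "frobenius_sq A = (\<Sum>j. \<Sum>i\<in>UNIV. ennreal ((A (i, j))\<^sup>2))"
    unfolding frobenius_sq_def by (rule suminf_sum[symmetric]) simp
  also have "\<dots> = (SUP k. \<Sum>j<k. \<Sum>i\<in>UNIV. ennreal ((A (i, j))\<^sup>2))"
    by (rule suminf_eq_SUP)
  also have "\<dots> = (SUP k. ennreal (column_sq k A))"
    unfolding column_sq_def sum.cartesian_product' by (subst sum.swap) (simp add: sum_nonneg)
  finally have "frobenius_sq A / 2 = (SUP k. ennreal (column_sq k A) / 2)"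
    by (simp add: SUP_divide_ennreal)
  also have "\<dots> = (SUP k. ennreal (column_sq k A / 2))"
    by (simp add: column_sq_nonneg divide_ennreal flip: ennreal_numeral)
  finally show ?thesis .
qed

lemma frobenius_rate_le_iff:
  assumes "0 \<le> y"
  shows "frobenius_sq A / 2 \<le> ennreal y \<longleftrightarrow> (\<forall>k. column_sq k A \<le> 2 * y)"
  unfolding frobenius_rate_eq_SUP SUP_le_iff using assms by (auto simp: column_sq_nonneg mult.commute)

lemma column_sq_le_frobenius_rate: "ennreal (column_sq k A / 2) \<le> frobenius_sq A / 2"
  unfolding frobenius_rate_eq_SUP by (rule SUP_upper) simp

lemma entry_sq_le_column_sq: "j < k \<Longrightarrow> (A (i, j))\<^sup>2 \<le> column_sq k A"
  unfolding column_sq_def by (intro member_le_sum) auto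

lemma tendsto_fun_iff:
  fixes f :: "'a \<Rightarrow> 'i \<Rightarrow> 'b::topological_space"
  shows "(f \<longlongrightarrow> l) F \<longleftrightarrow> (\<forall>i. ((\<lambda>a. f a i) \<longlongrightarrow> l i) F)"
  using limitin_componentwise[of "\<lambda>_. euclidean" UNIV f l F] by (simp add: euclidean_product_topology)

lemma rate_function_frobenius: "rate_function (\<lambda>A :: 'm::finite \<times> nat \<Rightarrow> real. frobenius_sq A / 2)"
  unfolding rate_function_def
proof (intro allI impI)
  fix y :: real assume y: "0 \<le> y"
  have "continuous_on UNIV (\<lambda>A :: 'm \<times> nat \<Rightarrow> real. column_sq k A)" for k
    unfolding column_sq_def by (intro continuous_intros continuous_on_product_coordinates)
  then show "closed {A :: 'm \<times> nat \<Rightarrow> real. frobenius_sq A / 2 \<le> ennreal y}"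
    unfolding frobenius_rate_le_iff[OF y] by (intro closed_Collect_all closed_Collect_le continuous_on_const)
qed

lemma compact_frobenius_sublevel:
  assumes y: "0 \<le> y"
  shows "compact {A :: 'm::finite \<times> nat \<Rightarrow> real. frobenius_sq A / 2 \<le> ennreal y}" (is "compact ?S")
proof -
  let ?K = "PiE (UNIV :: ('m \<times> nat) set) (\<lambda>_. {- sqrt (2 * y)..sqrt (2 * y)})"
  have "compactin (product_topology (\<lambda>_. euclidean) UNIV) ?K"
    unfolding compactin_PiE by simp
  then have "compact ?K" by (simp add: euclidean_product_topology)
  moreover have "closed ?S"
    using rate_function_frobenius y by (auto simp: rate_function_def)
  moreover have "?S \<subseteq> ?K"
  proof
    fix A :: "'m \<times> nat \<Rightarrow> real" assume "A \<in> ?S"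
    then have c: "column_sq k A \<le> 2 * y" for k
      using frobenius_rate_le_iff[OF y] by auto
    have "\<bar>A (i, j)\<bar> \<le> sqrt (2 * y)" for i j
      using order_trans[OF entry_sq_le_column_sq[of j "Suc j" A i] c] by (intro real_le_rsqrt) simp
    then show "A \<in> ?K" by (force simp: abs_le_iff)
  qed
  ultimately show ?thesis
    by (metis compact_Int_closed inf.absorb_iff2)
qed

lemma good_rate_function_frobenius: "good_rate_function (\<lambda>A :: 'm::finite \<times> nat \<Rightarrow> real. frobenius_sq A / 2)"
  using rate_function_frobenius compact_frobenius_sublevel by (auto simp: good_rate_function_def)

lemma convex_functional_frobenius: "convex_functional (\<lambda>A :: 'm::finite \<times> nat \<Rightarrow> real. frobenius_sq A / 2)"
  unfolding convex_functional_def
proof (intro allI impI)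
  fix A B :: "'m \<times> nat \<Rightarrow> real" and u v :: real
  assume uv: "0 \<le> u" "0 \<le> v" "u + v = 1"
  then have v: "v = 1 - u" by simp
  let ?C = "\<lambda>p. u * A p + v * B p"
  have "ennreal (column_sq k ?C / 2) \<le> ennreal u * (frobenius_sq A / 2) + ennreal v * (frobenius_sq B / 2)" for k
  proof -
    have "(u * a + v * b)\<^sup>2 \<le> u * a\<^sup>2 + v * b\<^sup>2" for a b :: real
    proof -
      have "u * a\<^sup>2 + v * b\<^sup>2 - (u * a + v * b)\<^sup>2 = u * v * (a - b)\<^sup>2"
        unfolding v by (simp add: power2_eq_square algebra_simps)
      also have "0 \<le> u * v * (a - b)\<^sup>2" using uv by simp
      finally show ?thesis by simp
    qed
    then have "column_sq k ?C \<le> (\<Sum>p\<in>UNIV \<times> {..<k}. u * (A p)\<^sup>2 + v * (B p)\<^sup>2)"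
      unfolding column_sq_def by (intro sum_mono)
    also have "\<dots> = u * column_sq k A + v * column_sq k B"
      by (simp add: column_sq_def sum.distrib sum_distrib_left)
    finally have "ennreal (column_sq k ?C / 2) \<le> ennreal (u * (column_sq k A / 2) + v * (column_sq k B / 2))"
      by (intro ennreal_leI) simp
    also have "\<dots> = ennreal u * ennreal (column_sq k A / 2) + ennreal v * ennreal (column_sq k B / 2)"
      using uv column_sq_nonneg[of k A] column_sq_nonneg[of k B]
      by (simp only: ennreal_plus ennreal_mult mult_nonneg_nonneg divide_nonneg_nonneg zero_le_numeral)
    also have "\<dots> \<le> ennreal u * (frobenius_sq A / 2) + ennreal v * (frobenius_sq B / 2)"
      by (intro add_mono mult_left_mono column_sq_le_frobenius_rate) auto
    finally show ?thesis .
  qed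
  then show "frobenius_sq ?C / 2 \<le> ennreal u * (frobenius_sq A / 2) + ennreal v * (frobenius_sq B / 2)"
    unfolding frobenius_rate_eq_SUP[of ?C] by (intro SUP_least)
qed

text \<open>The product topology has the cylinders over finitely many coordinates as a base; here they are
  enlarged to cylinders over full columns.\<close>

lemma open_contains_cylinder:
  fixes A :: "'m::finite \<times> nat \<Rightarrow> real"
  assumes "open U" "A \<in> U"
  shows "\<exists>k. \<exists>e>0. \<forall>X. (\<forall>p\<in>UNIV \<times> {..<k}. \<bar>X p - A p\<bar> < e) \<longrightarrow> X \<in> U"
proof (rule ccontr)
  assume "\<not> ?thesis"
  then have "\<forall>k. \<forall>e>0. \<exists>X. (\<forall>p\<in>UNIV \<times> {..<k}. \<bar>X p - A p\<bar> < e) \<and> X \<notin> U" by blast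
  then have "\<forall>k. \<exists>X. (\<forall>p\<in>UNIV \<times> {..<k}. \<bar>X p - A p\<bar> < inverse (real (Suc k))) \<and> X \<notin> U"
    by (metis inverse_positive_iff_positive of_nat_0_less_iff zero_less_Suc)
  then obtain X where X: "\<And>k p. p \<in> UNIV \<times> {..<k} \<Longrightarrow> \<bar>X k p - A p\<bar> < inverse (real (Suc k))" "\<And>k. X k \<notin> U"
    by metis
  have "X \<longlonglongrightarrow> A"
    unfolding tendsto_fun_iff
  proof
    fix p :: "'m \<times> nat"
    obtain i j where p: "p = (i, j)" by (cases p)
    show "(\<lambda>k. X k p) \<longlonglongrightarrow> A p"
    proof (rule LIM_zero_cancel, rule Lim_null_comparison)
      show "\<forall>\<^sub>F k in sequentially. norm (X k p - A p) \<le> inverse (real (Suc k))"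
        using eventually_gt_at_top[of j] by eventually_elim (use X(1) p in \<open>fastforce intro: less_imp_le\<close>)
      show "(\<lambda>k. inverse (real (Suc k))) \<longlonglongrightarrow> 0" by (rule LIMSEQ_inverse_real_of_nat)
    qed
  qed
  moreover have "closed (- U)" using assms(1) by (rule closed_Compl)
  ultimately have "A \<in> - U" using X(2) by (intro closed_sequentially[of "- U" X A]) auto
  then show False using assms by simp
qed

text \<open>The rate function depends on the norm only, so the large deviation upper bound for a closed set
  reduces to a tail estimate for the norm of finitely many columns. If no number of columns worked,
  truncating a counterexample \<open>X k\<close> after \<open>k\<close> columns would give a sequence in the compact sublevel
  set; the truncation does not affect coordinatewise limits, so a limit point would lie both in \<open>C\<close>
  and in the sublevel set.\<close>

lemma closed_above_rate_column_bound:
  fixes C :: "('m::finite \<times> nat \<Rightarrow> real) set"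
  assumes C: "closed C" and a: "0 \<le> a" "\<And>A. A \<in> C \<Longrightarrow> ennreal a < frobenius_sq A / 2"
  shows "\<exists>k. \<forall>A\<in>C. 2 * a < column_sq k A"
proof (rule ccontr)
  assume "\<not> ?thesis"
  then have "\<forall>k. \<exists>A\<in>C. column_sq k A \<le> 2 * a" by (auto simp: not_less)
  then obtain X where X: "\<And>k. X k \<in> C" "\<And>k. column_sq k (X k) \<le> 2 * a" by metis
  let ?K = "{A :: 'm \<times> nat \<Rightarrow> real. frobenius_sq A / 2 \<le> ennreal a}"
  define Y where "Y k = pad_columns k (X k)" for k
  have "column_sq n (Y k) \<le> 2 * a" for n k
  proof -
    have "column_sq n (Y k) = (\<Sum>p\<in>UNIV \<times> {..<min n k}. (X k p)\<^sup>2)"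
      unfolding column_sq_def by (rule sum.mono_neutral_cong_right) (auto simp: Y_def pad_columns_def split: if_splits)
    also have "\<dots> \<le> column_sq k (X k)"
      unfolding column_sq_def by (intro sum_mono2) auto
    finally show ?thesis using X(2)[of k] by simp
  qed
  then have "Y k \<in> ?K" for k by (simp add: frobenius_rate_le_iff[OF a(1)])
  moreover have "seq_compact ?K" using compact_frobenius_sublevel[OF a(1)] by (rule compact_imp_seq_compact)
  ultimately obtain A r where A: "A \<in> ?K" "strict_mono r" "(Y \<circ> r) \<longlonglongrightarrow> A"
    by (meson seq_compactE)
  have "(X \<circ> r) \<longlonglongrightarrow> A"
    unfolding tendsto_fun_iff
  proof
    fix p :: "'m \<times> nat"
    obtain i j where p: "p = (i, j)" by (cases p)
    have "(\<lambda>n. (Y \<circ> r) n p) \<longlonglongrightarrow> A p" using A(3) unfolding tendsto_fun_iff by blast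
    moreover have "\<forall>\<^sub>F n in sequentially. (Y \<circ> r) n p = (X \<circ> r) n p"
      using eventually_gt_at_top[of j]
    proof eventually_elim
      case (elim n)
      then have "j < r n" using seq_suble[OF A(2), of n] by simp
      then show ?case by (simp add: Y_def pad_columns_def p)
    qed
    ultimately show "(\<lambda>n. (X \<circ> r) n p) \<longlonglongrightarrow> A p" by (rule Lim_transform_eventually)
  qed
  then have "A \<in> C" using C X(1) by (intro closed_sequentially[of C "X \<circ> r" A]) auto
  then show False using a(2)[of A] A(1) by simp
qed

section \<open>Exponential estimates for the first columns of a Haar matrix\<close>

lemma stiefel_norm_tail:
  fixes \<kappa> :: real and k :: nat
  assumes "0 < \<kappa>" "\<kappa> < 1"
  shows "\<exists>C>0. \<forall>\<^sub>F N in sequentially. \<forall>\<mu> :: ('m::finite \<times> nat \<Rightarrow> real) measure. stiefel_haar N \<mu> \<longrightarrow> (\<forall>r\<ge>0.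
     measure \<mu> {V\<in>space \<mu>. r \<le> L2_set V (UNIV \<times> {..<k})} \<le> C * exp (- ((1 - \<kappa>) / 2 * (real N * r\<^sup>2))))"
proof -
  let ?J = "(UNIV :: 'm set) \<times> {..<k}"
  \<comment> \<open>the loss \<open>\<kappa>\<close> is split over three factors: the exponent \<open>a = 1 - q < 1\<close> and the squared comparison constant\<close>
  define q where "q = \<kappa> / 3"
  have q: "0 < q" "q < 1" using assms by (auto simp: q_def)
  have cube: "1 - \<kappa> \<le> (1 - q) ^ 3"
    using Bernoulli_inequality[of "- q" 3] q by (simp add: q_def)
  obtain \<delta> where \<delta>: "\<delta> > 0" and cmp: "\<forall>N\<ge>k. N > 0 \<longrightarrow> (\<forall>H\<in>gram_close N k \<delta>. \<exists>B\<in>orthogonal_group N. \<forall>V::'m::finite \<times> nat \<Rightarrow> real.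
     L2_set (\<lambda>p. project N V H p / sqrt (real N) - rotate_columns N B V p) (UNIV \<times> {..<k})
       \<le> q * L2_set (rotate_columns N B V) (UNIV \<times> {..<k}))"
    using gram_close_comparison[OF q(1), of k, where 'm = 'm] by blast
  obtain c where c: "c > 0" and gram: "\<And>N. emeasure (gauss_matrix N k) (space (gauss_matrix N k) - gram_close N k \<delta>)
     \<le> ennreal (2 * (real k)\<^sup>2 * exp (- c * real N))"
    using gram_close_probability[OF \<delta>, of k] by blast
  define K where "K = (1 / sqrt (1 - (1 - q))) ^ (CARD('m) * k)"
  have K: "K > 0" using q by (simp add: K_def)
  have "(\<lambda>N. 2 * (real k)\<^sup>2 * exp (- c * real N)) \<longlonglongrightarrow> 0"
    using c by real_asymp
  then have "\<forall>\<^sub>F N in sequentially. 2 * (real k)\<^sup>2 * exp (- c * real N) < 1 / 2"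
    by (rule order_tendstoD) simp
  then have "\<forall>\<^sub>F N in sequentially. \<forall>\<mu> :: ('m \<times> nat \<Rightarrow> real) measure. stiefel_haar N \<mu> \<longrightarrow> (\<forall>r\<ge>0.
     measure \<mu> {V\<in>space \<mu>. r \<le> L2_set V ?J} \<le> 2 * K * exp (- ((1 - \<kappa>) / 2 * (real N * r\<^sup>2))))"
    using eventually_ge_at_top[of k] eventually_gt_at_top[of 0]
  proof eventually_elim
    case (elim N)
    let ?G = "gauss_matrix N k"
    let ?E = "gram_close N k \<delta>"
    interpret g: prob_space ?G by (rule prob_space_gauss_matrix)
    have "emeasure ?G (space ?G - ?E) \<le> ennreal (1 / 2)"
      using gram[of N] elim(1) by (meson ennreal_leI less_imp_le order_trans)
    then have "g.prob (space ?G - ?E) \<le> 1 / 2"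
      by (subst (asm) g.emeasure_eq_measure, subst (asm) ennreal_le_iff) auto
    then have half: "1 / 2 \<le> g.prob ?E"
      using g.prob_compl[OF gram_close_sets, of \<delta>] by simp
    show ?case
    proof (intro allI impI)
      fix \<mu> :: "('m \<times> nat \<Rightarrow> real) measure" and r :: real
      assume \<mu>: "stiefel_haar N \<mu>" and r: "0 \<le> r"
      interpret mu: prob_space \<mu> using \<mu> by (simp add: stiefel_haar_def)
      let ?S = "{V\<in>space \<mu>. r \<le> L2_set V ?J}"
      let ?x = "(1 - q) / 2 * (real N * ((1 - q) * r)\<^sup>2)"
      have "ennreal (exp ?x) * emeasure \<mu> ?S * emeasure ?G ?E \<le> ennreal K"
        unfolding K_def using q elim r cmp \<mu>
        by (intro haar_norm_tail[where \<kappa> = q and a = "1 - q"] haar_norm_sets gram_close_sets) auto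
      then have "exp ?x * mu.prob ?S * g.prob ?E \<le> K"
        using K by (simp add: mu.emeasure_eq_measure g.emeasure_eq_measure flip: ennreal_mult')
      moreover have "exp ?x * mu.prob ?S * (1 / 2) \<le> exp ?x * mu.prob ?S * g.prob ?E"
        using half by (intro mult_left_mono) auto
      ultimately have "exp ?x * mu.prob ?S \<le> 2 * K" by linarith
      then have "exp (- ?x) * (exp ?x * mu.prob ?S) \<le> exp (- ?x) * (2 * K)"
        by (intro mult_left_mono) auto
      then have "mu.prob ?S \<le> 2 * K * exp (- ?x)"
        by (simp add: exp_minus field_simps)
      also have "\<dots> \<le> 2 * K * exp (- ((1 - \<kappa>) / 2 * (real N * r\<^sup>2)))"
      proof -
        have "?x = (1 - q) ^ 3 / 2 * (real N * r\<^sup>2)"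
          by (simp add: power2_eq_square power3_eq_cube mult_ac)
        moreover have "(1 - \<kappa>) / 2 * (real N * r\<^sup>2) \<le> (1 - q) ^ 3 / 2 * (real N * r\<^sup>2)"
          using cube by (intro mult_right_mono) auto
        ultimately have "(1 - \<kappa>) / 2 * (real N * r\<^sup>2) \<le> ?x" by linarith
        then show ?thesis
          using K by (intro mult_left_mono) (simp_all only: exp_le_cancel_iff neg_le_iff_le)
      qed
      finally show "measure \<mu> ?S \<le> 2 * K * exp (- ((1 - \<kappa>) / 2 * (real N * r\<^sup>2)))" .
    qed
  qed
  then show ?thesis using K by (intro exI[of _ "2 * K"]) auto
qed

text \<open>With \<open>b = 1 / \<beta>\<close> the number \<open>N b\<^sup>2\<close> is the speed of the large deviation principle.\<close>

lemma stiefel_box_lower: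
  fixes a :: "'m::finite \<times> nat \<Rightarrow> real"
  defines "J \<equiv> \<lambda>k::nat. (UNIV :: 'm set) \<times> {..<k}"
  assumes "0 < \<epsilon>" "0 < \<eta>"
  shows "\<exists>e>0. \<exists>c>0. \<forall>N\<ge>k. N > 0 \<longrightarrow> (\<forall>\<mu> :: ('m \<times> nat \<Rightarrow> real) measure. stiefel_haar N \<mu> \<longrightarrow> (\<forall>b>0.
     exp (- (real N * b\<^sup>2) * (column_sq k a / 2 + \<eta>)) * (1 - 2 * card (J k) * exp (- e\<^sup>2 * (real N * b\<^sup>2) / 2))
       - 2 * (real k)\<^sup>2 * exp (- c * real N)
     \<le> measure \<mu> {V\<in>space \<mu>. \<forall>p\<in>J k. \<bar>V p - b * a p\<bar> < \<epsilon> * b}))"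
proof -
  define l where "l = (\<Sum>p\<in>J k. \<bar>a p\<bar>)"
  have l: "0 \<le> l" by (simp add: l_def sum_nonneg)
  define e where "e = min (\<epsilon> / 2) (\<eta> / (l + 1))"
  have e: "0 < e" "e \<le> \<epsilon> / 2" "e * l \<le> \<eta>"
  proof -
    show "0 < e" using assms l by (auto simp: e_def)
    show "e \<le> \<epsilon> / 2" unfolding e_def by (rule min.cobounded1)
    have "e * l \<le> \<eta> / (l + 1) * l" using l by (intro mult_right_mono) (auto simp: e_def)
    also have "\<dots> \<le> \<eta>" using assms l by (simp add: field_simps)
    finally show "e * l \<le> \<eta>" .
  qed
  define s where "s = (\<Sum>p\<in>J k. \<bar>a p\<bar> + e)"
  have s: "0 \<le> s" using e by (simp add: s_def sum_nonneg)
  define \<kappa> where "\<kappa> = min (1 / 2) (\<epsilon> / (4 * (s + 1)))"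
  have \<kappa>: "0 < \<kappa>" "\<kappa> \<le> 1 / 2" "e + 2 * \<kappa> * s \<le> \<epsilon>"
  proof -
    show "0 < \<kappa>" using assms s by (auto simp: \<kappa>_def)
    show "\<kappa> \<le> 1 / 2" unfolding \<kappa>_def by (rule min.cobounded1)
    have "\<kappa> * s \<le> \<epsilon> / (4 * (s + 1)) * s" using s by (intro mult_right_mono) (auto simp: \<kappa>_def)
    also have "\<dots> \<le> \<epsilon> / 4" using assms s by (simp add: field_simps)
    finally show "e + 2 * \<kappa> * s \<le> \<epsilon>" using e by simp
  qed
  obtain \<delta> where \<delta>: "\<delta> > 0" and cmp: "\<forall>N\<ge>k. N > 0 \<longrightarrow> (\<forall>H\<in>gram_close N k \<delta>. \<exists>B\<in>orthogonal_group N. \<forall>V::'m::finite \<times> nat \<Rightarrow> real.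
     L2_set (\<lambda>p. project N V H p / sqrt (real N) - rotate_columns N B V p) (UNIV \<times> {..<k})
       \<le> \<kappa> * L2_set (rotate_columns N B V) (UNIV \<times> {..<k}))"
    using gram_close_comparison[OF \<kappa>(1), of k, where 'm = 'm] by blast
  obtain c where c: "c > 0" and gram: "\<And>N. emeasure (gauss_matrix N k) (space (gauss_matrix N k) - gram_close N k \<delta>)
     \<le> ennreal (2 * (real k)\<^sup>2 * exp (- c * real N))"
    using gram_close_probability[OF \<delta>, of k] by blast
  show ?thesis
  proof (rule exI[of _ e], intro conjI e(1), rule exI[of _ c], intro conjI c allI impI)
    fix N and \<mu> :: "('m \<times> nat \<Rightarrow> real) measure" and b :: real
    assume N: "k \<le> N" "0 < N" and \<mu>: "stiefel_haar N \<mu>" and b: "0 < b"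
    interpret mu: prob_space \<mu> using \<mu> by (simp add: stiefel_haar_def)
    let ?S = "{V\<in>space \<mu>. \<forall>p\<in>J k. \<bar>V p - b * a p\<bar> < \<epsilon> * b}"
    let ?t = "real N * b\<^sup>2"
    let ?f = "1 - 2 * card (J k) * exp (- e\<^sup>2 * ?t / 2)"
    let ?g = "2 * (real k)\<^sup>2 * exp (- c * real N)"
    show "exp (- ?t * (column_sq k a / 2 + \<eta>)) * ?f - ?g \<le> measure \<mu> ?S"
    proof (cases "0 \<le> ?f")
      case False
      then have "exp (- ?t * (column_sq k a / 2 + \<eta>)) * ?f \<le> 0" by (intro mult_nonneg_nonpos) auto
      moreover have "0 \<le> ?g" by simp
      ultimately show ?thesis using measure_nonneg[of \<mu> ?S] by linarith
    next
      case True
      have "ennreal (exp (- ?t * ((\<Sum>p\<in>J k. (a p)\<^sup>2) / 2 + e * (\<Sum>p\<in>J k. \<bar>a p\<bar>))) * ?f)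
        \<le> emeasure \<mu> ?S + emeasure (gauss_matrix N k) (space (gauss_matrix N k) - gram_close N k \<delta>)"
        unfolding J_def using \<mu> e \<kappa> N b cmp
        by (intro haar_box_lower[where \<kappa> = \<kappa>] gram_close_sets) (auto simp: s_def J_def)
      also have "\<dots> \<le> emeasure \<mu> ?S + ennreal ?g"
        by (intro add_left_mono gram)
      finally have "exp (- ?t * ((\<Sum>p\<in>J k. (a p)\<^sup>2) / 2 + e * (\<Sum>p\<in>J k. \<bar>a p\<bar>))) * ?f \<le> mu.prob ?S + ?g"
        by (simp add: mu.emeasure_eq_measure flip: ennreal_plus)
      moreover have "exp (- ?t * (column_sq k a / 2 + \<eta>)) \<le> exp (- ?t * ((\<Sum>p\<in>J k. (a p)\<^sup>2) / 2 + e * (\<Sum>p\<in>J k. \<bar>a p\<bar>)))"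
        using e(3) by (auto simp: column_sq_def J_def l_def intro!: mult_left_mono)
      then have "exp (- ?t * (column_sq k a / 2 + \<eta>)) * ?f \<le> exp (- ?t * ((\<Sum>p\<in>J k. (a p)\<^sup>2) / 2 + e * (\<Sum>p\<in>J k. \<bar>a p\<bar>))) * ?f"
        using True by (rule mult_right_mono)
      ultimately show ?thesis by linarith
    qed
  qed
qed


section \<open>The large deviation principle\<close>

lemma le_enn2ereal_INF:
  assumes "\<And>x. x \<in> U \<Longrightarrow> y \<le> enn2ereal (I x)"
  shows "y \<le> enn2ereal (INF x\<in>U. I x)"
proof (cases "0 \<le> y")
  case True
  have "e2ennreal y \<le> (INF x\<in>U. I x)"
    using True assms by (intro INF_greatest) (simp add: less_eq_ennreal.rep_eq enn2ereal_e2ennreal)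
  then show ?thesis
    using True by (simp add: less_eq_ennreal.rep_eq enn2ereal_e2ennreal)
next
  case False
  then show ?thesis
    using enn2ereal_nonneg[of "INF x\<in>U. I x"] by (meson linear order_trans)
qed

text \<open>Exponential bounds on probabilities in the form in which a large deviation principle asks for them;
  the value \<open>- \<infinity>\<close> of the logarithm at 0 is harmless in the upper bound.\<close>

lemma scaled_ext_ln_le:
  assumes "0 < s" "p \<le> exp (- s * x)" "0 \<le> p"
  shows "ereal (1 / s) * ext_ln p \<le> ereal (- x)"
proof (cases "p = 0")
  case True
  then show ?thesis using assms(1) by (simp add: ext_ln_def)
next
  case False
  then have "ln p \<le> ln (exp (- s * x))" using assms by (subst ln_le_cancel_iff) auto
  then have "ln p \<le> - s * x" by simp
  then show ?thesis using False assms by (simp add: ext_ln_def field_simps)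
qed

lemma scaled_ext_ln_ge:
  assumes "0 < s" "exp (- s * x) \<le> p"
  shows "ereal (- x) \<le> ereal (1 / s) * ext_ln p"
proof -
  have p: "0 < p" using assms(2) exp_gt_zero[of "- s * x"] by linarith
  have "- s * x \<le> ln p" using assms(2) p by (simp add: ln_ge_iff)
  then show ?thesis using p assms by (simp add: ext_ln_def field_simps)
qed

theorem theorem2:
  fixes M :: "nat \<Rightarrow> 'w measure"
    and V :: "nat \<Rightarrow> 'w \<Rightarrow> ('m::finite \<times> nat \<Rightarrow> real)"
    and \<beta> :: "nat \<Rightarrow> real"
  assumes "\<And>N. N \<ge> CARD('m) \<Longrightarrow> prob_space (M N)"
    and "\<And>N. N \<ge> CARD('m) \<Longrightarrow> V N \<in> M N \<rightarrow>\<^sub>M stiefel_borel N"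
    and "\<And>N. N \<ge> CARD('m) \<Longrightarrow> stiefel_haar N (distr (M N) (stiefel_borel N) (V N))"
    and "\<And>N. N \<ge> CARD('m) \<Longrightarrow> \<beta> N > 0"
    and "filterlim \<beta> at_top sequentially"
    and "\<beta> \<in> o(\<lambda>N. sqrt (real N))"
  shows "satisfies_LDP M (\<lambda>N \<omega> p. \<beta> N * pad_columns N (V N \<omega>) p) (\<lambda>N. real N / (\<beta> N)\<^sup>2)
           (\<lambda>A. frobenius_sq A / 2)
       \<and> good_rate_function (\<lambda>A :: 'm \<times> nat \<Rightarrow> real. frobenius_sq A / 2)
       \<and> convex_functional (\<lambda>A :: 'm \<times> nat \<Rightarrow> real. frobenius_sq A / 2)"
proof -
  let ?I = "\<lambda>A :: 'm \<times> nat \<Rightarrow> real. frobenius_sq A / 2"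
  let ?X = "\<lambda>N \<omega> p. \<beta> N * pad_columns N (V N \<omega>) p"
  define s where "s N = real N / (\<beta> N)\<^sup>2" for N
  define \<mu> where "\<mu> N = distr (M N) (stiefel_borel N) (V N)" for N
  define Q where "Q U N = measure (M N) {\<omega> \<in> space (M N). ?X N \<omega> \<in> U}" for U N
  note large = eventually_ge_at_top[of "CARD('m)"]
  have haar: "stiefel_haar N (\<mu> N)" if "CARD('m) \<le> N" for N
    using assms(3)[OF that] by (simp add: \<mu>_def)
  have sets_\<mu>: "sets (\<mu> N) = sets (stiefel_borel N)" for N
    by (simp add: \<mu>_def)
  have XM: "?X N \<in> borel_measurable (M N)" if N: "CARD('m) \<le> N" for N
  proof (rule measurable_coordinatewise_then_product)
    fix p :: "'m \<times> nat"
    obtain i j where p: "p = (i, j)" by (cases p)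
    show "(\<lambda>\<omega>. ?X N \<omega> p) \<in> borel_measurable (M N)"
    proof (cases "j < N")
      case True
      have "(\<lambda>V. V (i, j)) \<in> borel_measurable (\<mu> N)"
        using haar_entry_measurable[OF haar[OF N] True] .
      then have "(\<lambda>V. V (i, j)) \<in> borel_measurable (stiefel_borel N)" by (simp add: \<mu>_def)
      from measurable_compose[OF assms(2)[OF N] this] show ?thesis
        using True by (simp add: p pad_columns_def)
    qed (simp add: p pad_columns_def)
  qed
  have transfer: "measure (\<mu> N) {v\<in>space (\<mu> N). P v} = measure (M N) {\<omega>\<in>space (M N). P (V N \<omega>)}"
    if "CARD('m) \<le> N" "{v\<in>space (\<mu> N). P v} \<in> sets (\<mu> N)" for N P
  proof -
    have "V N -` {v\<in>space (\<mu> N). P v} \<inter> space (M N) = {\<omega>\<in>space (M N). P (V N \<omega>)}"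
      using measurable_space[OF assms(2)[OF that(1)]] by (auto simp: \<mu>_def)
    then show ?thesis
      using measure_distr[OF assms(2)[OF that(1)], of "{v\<in>space (\<mu> N). P v}"] that(2) by (simp add: \<mu>_def)
  qed
  have speed: "filterlim s at_top sequentially"
  proof -
    have "(\<lambda>N. \<beta> N / sqrt (real N)) \<longlonglongrightarrow> 0" by (rule smalloD_tendsto[OF assms(6)])
    then have "(\<lambda>N. (\<beta> N / sqrt (real N))\<^sup>2) \<longlonglongrightarrow> 0\<^sup>2" by (intro tendsto_power)
    then have "(\<lambda>N. (\<beta> N / sqrt (real N))\<^sup>2) \<longlonglongrightarrow> 0" by simp
    moreover have "\<forall>\<^sub>F N in sequentially. (\<beta> N / sqrt (real N))\<^sup>2 > 0"
      using large eventually_gt_at_top[of 0]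
      by eventually_elim (use assms(4) in \<open>force simp: zero_less_power2\<close>)
    ultimately have "filterlim (\<lambda>N. inverse ((\<beta> N / sqrt (real N))\<^sup>2)) at_top sequentially"
      by (rule filterlim_inverse_at_top)
    then show ?thesis by (simp add: s_def[abs_def] power_divide)
  qed
  have s1: "\<forall>\<^sub>F N in sequentially. 0 < s N"
    using speed by (rule filterlim_at_top_dense[THEN iffD1, rule_format])
  have prob: "\<forall>\<^sub>F N in sequentially. prob_space (M N) \<and> ?X N \<in> borel_measurable (M N)"
    using large by eventually_elim (use assms(1) XM in auto)
  have lower: "- enn2ereal (INF x\<in>U. ?I x) \<le> liminf (\<lambda>N. ereal (1 / s N) * ext_ln (Q U N))" if U: "open U" for U
  proof -
    let ?L = "liminf (\<lambda>N. ereal (1 / s N) * ext_ln (Q U N))"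
    have point: "- enn2ereal (?I A) \<le> ?L" if A: "A \<in> U" for A
    proof (cases "?I A = \<infinity>")
      case False
      then obtain x where x: "0 \<le> x" "?I A = ennreal x"
        by (metis ennreal_cases infinity_ennreal_def)
      obtain k \<epsilon> where \<epsilon>: "\<epsilon> > 0" and cyl: "\<And>X. (\<forall>p\<in>UNIV \<times> {..<k}. \<bar>X p - A p\<bar> < \<epsilon>) \<Longrightarrow> X \<in> U"
        using open_contains_cylinder[OF U A] by blast
      have kx: "column_sq k A / 2 \<le> x"
        using column_sq_le_frobenius_rate[of k A] x by (simp add: column_sq_nonneg)
      have "ereal (- x - \<eta>) \<le> ?L" if "\<eta> > 0" for \<eta>
      proof -
        let ?J = "(UNIV :: 'm set) \<times> {..<k}"
        have "0 < \<eta> / 2" using that by simp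
        from stiefel_box_lower[OF \<epsilon> this, of k A] obtain e c where e: "e > 0" and c: "c > 0"
          and box: "\<And>N \<nu> b. k \<le> N \<Longrightarrow> N > 0 \<Longrightarrow> stiefel_haar N \<nu> \<Longrightarrow> b > 0 \<Longrightarrow>
             exp (- (real N * b\<^sup>2) * (column_sq k A / 2 + \<eta> / 2)) * (1 - 2 * card ?J * exp (- e\<^sup>2 * (real N * b\<^sup>2) / 2))
               - 2 * (real k)\<^sup>2 * exp (- c * real N)
             \<le> measure \<nu> {V\<in>space \<nu>. \<forall>p\<in>?J. \<bar>V p - b * A p\<bar> < \<epsilon> * b}"
          by (elim exE conjE) (rule that, assumption, assumption, simp)
        \<comment> \<open>half of \<open>\<eta>\<close> is spent on the box, the other half absorbs the factor \<open>1 / 2\<close> from \<open>?h\<close>\<close>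
        define y where "y = x + \<eta> / 2"
        let ?h = "\<lambda>t. (1 - 2 * card ?J * exp (- e\<^sup>2 * t / 2)) - 2 * (real k)\<^sup>2 * exp (- t)"
        have "((\<lambda>t. ?h t) \<longlongrightarrow> 1) at_top" using e by real_asymp
        then have h: "\<forall>\<^sub>F N in sequentially. 1 / 2 < ?h (s N)"
          by (intro order_tendstoD(1)[OF filterlim_compose[OF _ speed]]) auto
        have "((\<lambda>t. exp (- \<eta> / 2 * t)) \<longlongrightarrow> 0) at_top" using that by real_asymp
        then have h2: "\<forall>\<^sub>F N in sequentially. exp (- \<eta> / 2 * s N) < 1 / 2"
          by (intro order_tendstoD(2)[OF filterlim_compose[OF _ speed]]) auto
        \<comment> \<open>from here on \<open>c N = c \<beta>\<^sup>2 s\<close> exceeds \<open>(y + 1) s\<close>, so the exceptional Gaussian matrices are negligible\<close>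
        have "\<forall>\<^sub>F N in sequentially. (y + 1) / c + 1 < \<beta> N"
          using assms(5) by (rule filterlim_at_top_dense[THEN iffD1, rule_format])
        then have "\<forall>\<^sub>F N in sequentially. ereal (- x - \<eta>) \<le> ereal (1 / s N) * ext_ln (Q U N)"
          using h h2 s1 large eventually_ge_at_top[of k]
        proof eventually_elim
          case (elim N)
          have \<beta>: "\<beta> N > 0" using assms(4) elim by blast
          have N: "N > 0" using elim by (simp add: s_def zero_less_divide_iff)
          interpret mm: prob_space "M N" using assms(1) elim by blast
          define b where "b = 1 / \<beta> N"
          have b: "b > 0" "real N * b\<^sup>2 = s N" using \<beta> by (auto simp: b_def s_def power_divide)
          have "0 \<le> (y + 1) / c" using c x \<open>\<eta> > 0\<close> by (simp add: y_def)
          then have "1 \<le> \<beta> N" "(y + 1) / c \<le> \<beta> N" using elim(1) by linarith+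
          then have "(y + 1) / c \<le> (\<beta> N)\<^sup>2" using self_le_power[of "\<beta> N" 2] by linarith
          then have "y + 1 \<le> c * (\<beta> N)\<^sup>2"
            using c by (simp add: pos_divide_le_eq mult.commute)
          then have "(y + 1) * s N \<le> c * (\<beta> N)\<^sup>2 * s N" using elim by (intro mult_right_mono) auto
          also have "\<dots> = c * real N" using \<beta> by (simp add: s_def)
          finally have cN: "exp (- c * real N) \<le> exp (- s N * y) * exp (- s N)"
            by (simp add: algebra_simps flip: exp_add)
          have hpos: "0 \<le> 1 - 2 * card ?J * exp (- e\<^sup>2 * s N / 2)"
          proof -
            have "0 \<le> 2 * (real k)\<^sup>2 * exp (- s N)" by simp
            then show ?thesis using elim(2) by linarith
          qed
          have distrib: "p * (q - y * z) = p * q - y * (p * z)" for p q y z :: real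
            by (simp add: algebra_simps)
          have "exp (- s N * (x + \<eta>)) = exp (- s N * y) * exp (- \<eta> / 2 * s N)"
            by (simp add: y_def algebra_simps flip: exp_add)
          also have "\<dots> \<le> exp (- s N * y) * ?h (s N)"
            using elim by (intro mult_left_mono) auto
          also have "\<dots> = exp (- s N * y) * (1 - 2 * card ?J * exp (- e\<^sup>2 * s N / 2)) - 2 * (real k)\<^sup>2 * (exp (- s N * y) * exp (- s N))"
            by (rule distrib)
          also have "\<dots> \<le> exp (- s N * (column_sq k A / 2 + \<eta> / 2)) * (1 - 2 * card ?J * exp (- e\<^sup>2 * s N / 2)) - 2 * (real k)\<^sup>2 * exp (- c * real N)"
            using cN kx hpos elim(4) by (intro diff_mono mult_right_mono mult_left_mono) (auto simp: y_def)
          also have "\<dots> \<le> measure (\<mu> N) {v\<in>space (\<mu> N). \<forall>p\<in>?J. \<bar>v p - b * A p\<bar> < \<epsilon> * b}"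
            using box[OF elim(6) N haar[OF elim(5)] b(1)] unfolding b(2) .
          also have "\<dots> = measure (M N) {\<omega>\<in>space (M N). \<forall>p\<in>?J. \<bar>V N \<omega> p - b * A p\<bar> < \<epsilon> * b}"
            using elim haar by (intro transfer haar_box_sets) auto
          also have "\<dots> \<le> Q U N"
            unfolding Q_def
          proof (intro mm.finite_measure_mono)
            show "{\<omega> \<in> space (M N). ?X N \<omega> \<in> U} \<in> sets (M N)"
            proof -
              have "{\<omega> \<in> space (M N). ?X N \<omega> \<in> U} = ?X N -` U \<inter> space (M N)" by auto
              then show ?thesis using measurable_sets[OF XM[OF elim(5)] borel_open[OF U]] by simp
            qed
            show "{\<omega>\<in>space (M N). \<forall>p\<in>?J. \<bar>V N \<omega> p - b * A p\<bar> < \<epsilon> * b} \<subseteq> {\<omega> \<in> space (M N). ?X N \<omega> \<in> U}"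
            proof safe
              fix \<omega> assume \<omega>: "\<forall>p\<in>?J. \<bar>V N \<omega> p - b * A p\<bar> < \<epsilon> * b"
              show "?X N \<omega> \<in> U"
              proof (rule cyl, rule ballI)
                fix p assume p: "p \<in> ?J"
                then have "pad_columns N (V N \<omega>) p = V N \<omega> p" using elim(6) by (auto simp: pad_columns_def)
                moreover have "\<beta> N * V N \<omega> p - A p = \<beta> N * (V N \<omega> p - b * A p)"
                  using \<beta> by (simp add: b_def field_simps)
                moreover have "\<beta> N * \<bar>V N \<omega> p - b * A p\<bar> < \<beta> N * (\<epsilon> * b)"
                  using \<omega> p \<beta> by (intro mult_strict_left_mono) auto
                ultimately show "\<bar>\<beta> N * pad_columns N (V N \<omega>) p - A p\<bar> < \<epsilon>"
                  using \<beta> by (simp add: abs_mult b_def)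
              qed
            qed
          qed
          finally have "exp (- s N * (x + \<eta>)) \<le> Q U N" .
          from scaled_ext_ln_ge[OF elim(4) this] show ?case by simp
        qed
        then show ?thesis by (rule Liminf_bounded)
      qed
      then have slack: "ereal (- x - \<eta>) \<le> ?L" if "\<eta> > 0" for \<eta>
        using that by blast
      have "ereal (- x) \<le> ?L"
      proof (rule ccontr)
        assume "\<not> ereal (- x) \<le> ?L"
        then obtain z where z: "?L < ereal z" "ereal z < ereal (- x)"
          using ereal_dense2[of ?L "ereal (- x)"] by (meson not_le)
        then show False using slack[of "- x - z"] by simp
      qed
      then show ?thesis using x by (simp add: enn2ereal_ennreal)
    qed simp
    have "- ?L \<le> enn2ereal (INF x\<in>U. ?I x)"
      using point by (intro le_enn2ereal_INF) (simp add: ereal_uminus_le_reorder)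
    then show ?thesis by (simp add: ereal_uminus_le_reorder)
  qed
  have upper: "limsup (\<lambda>N. ereal (1 / s N) * ext_ln (Q C N)) \<le> - enn2ereal (INF x\<in>C. ?I x)" if C: "closed C" for C
  proof -
    let ?L = "limsup (\<lambda>N. ereal (1 / s N) * ext_ln (Q C N))"
    have zero: "?L \<le> 0"
    proof (rule Limsup_bounded)
      show "\<forall>\<^sub>F N in sequentially. ereal (1 / s N) * ext_ln (Q C N) \<le> 0"
        using s1 large
      proof eventually_elim
        case (elim N)
        interpret mm: prob_space "M N" using assms(1) elim by blast
        have "Q C N \<le> exp (- s N * 0)" by (simp add: Q_def)
        from scaled_ext_ln_le[OF elim(1) this] show ?case by (simp add: Q_def zero_ereal_def)
      qed
    qed
    have bound: "?L \<le> ereal (- a)" if a: "0 \<le> a" "ennreal a < (INF x\<in>C. ?I x)" for a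
    proof -
      \<comment> \<open>the gap between \<open>a\<close> and \<open>a'\<close> pays for the constant \<open>K\<close> and the factor \<open>1 - \<kappa>\<close> in the tail bound\<close>
      obtain a' where a': "a < a'" "ennreal a' < (INF x\<in>C. ?I x)"
      proof -
        obtain z where z: "ennreal a < z" "z < (INF x\<in>C. ?I x)" using dense[OF a(2)] by blast
        then obtain a' where "0 \<le> a'" "z = ennreal a'" by (metis ennreal_cases top.not_eq_extremum less_trans top_greatest leD)
        then show ?thesis using z a that by (auto simp: ennreal_less_iff)
      qed
      have "ennreal a' < ?I A" if "A \<in> C" for A
        using a'(2) INF_lower[OF that, of ?I] by simp
      then obtain k where k: "\<And>A. A \<in> C \<Longrightarrow> 2 * a' < column_sq k A"
        using closed_above_rate_column_bound[OF C, of a'] a a' by auto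
      \<comment> \<open>then \<open>(1 - \<kappa>) a'\<close> is the midpoint of \<open>a\<close> and \<open>a'\<close>\<close>
      define \<kappa> where "\<kappa> = (a' - a) / (2 * a')"
      have \<kappa>: "0 < \<kappa>" "\<kappa> < 1" "a < (1 - \<kappa>) * a'"
        using a a' by (auto simp: \<kappa>_def field_simps)
      obtain K where K: "K > 0" and tail: "\<forall>\<^sub>F N in sequentially. \<forall>\<nu> :: ('m \<times> nat \<Rightarrow> real) measure. stiefel_haar N \<nu> \<longrightarrow> (\<forall>r\<ge>0.
         measure \<nu> {V\<in>space \<nu>. r \<le> L2_set V (UNIV \<times> {..<k})} \<le> K * exp (- ((1 - \<kappa>) / 2 * (real N * r\<^sup>2))))"
        using stiefel_norm_tail[OF \<kappa>(1,2), of k, where 'm = 'm] by blast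
      define d where "d = (1 - \<kappa>) * a' - a"
      have d: "d > 0" using \<kappa> by (simp add: d_def)
      have "((\<lambda>t. K * exp (- d * t)) \<longlongrightarrow> 0) at_top" using d by real_asymp
      then have "\<forall>\<^sub>F N in sequentially. K * exp (- d * s N) < 1"
        by (intro order_tendstoD(2)[OF filterlim_compose[OF _ speed]]) auto
      then have "\<forall>\<^sub>F N in sequentially. ereal (1 / s N) * ext_ln (Q C N) \<le> ereal (- a)"
        using tail s1 large eventually_ge_at_top[of k]
      proof eventually_elim
        case (elim N)
        have \<beta>: "\<beta> N > 0" using assms(4) elim by blast
        interpret mm: prob_space "M N" using assms(1) elim by blast
        define r where "r = sqrt (2 * a') / \<beta> N"
        have r: "0 \<le> r" "(1 - \<kappa>) / 2 * (real N * r\<^sup>2) = (1 - \<kappa>) * a' * s N"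
          using \<beta> a a' by (auto simp: r_def s_def power_divide)
        let ?J = "(UNIV :: 'm set) \<times> {..<k}"
        have Sm: "{v\<in>space (\<mu> N). r \<le> L2_set v ?J} \<in> sets (\<mu> N)"
          using elim haar by (intro haar_norm_sets) auto
        have "Q C N \<le> measure (M N) {\<omega>\<in>space (M N). r \<le> L2_set (V N \<omega>) ?J}"
          unfolding Q_def
        proof (intro mm.finite_measure_mono)
          have "V N -` {v\<in>space (\<mu> N). r \<le> L2_set v ?J} \<inter> space (M N) \<in> sets (M N)"
            using Sm by (intro measurable_sets[OF assms(2)[OF elim(4)]]) (simp only: sets_\<mu>)
          also have "V N -` {v\<in>space (\<mu> N). r \<le> L2_set v ?J} \<inter> space (M N) = {\<omega>\<in>space (M N). r \<le> L2_set (V N \<omega>) ?J}"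
            using measurable_space[OF assms(2)[OF elim(4)]] by (auto simp: \<mu>_def)
          finally show "{\<omega>\<in>space (M N). r \<le> L2_set (V N \<omega>) ?J} \<in> sets (M N)" .
          show "{\<omega> \<in> space (M N). ?X N \<omega> \<in> C} \<subseteq> {\<omega>\<in>space (M N). r \<le> L2_set (V N \<omega>) ?J}"
          proof safe
            fix \<omega> assume "?X N \<omega> \<in> C"
            from k[OF this] have "2 * a' < column_sq k (?X N \<omega>)" .
            also have "\<dots> = (\<Sum>p\<in>?J. (\<beta> N * V N \<omega> p)\<^sup>2)"
              unfolding column_sq_def using elim(5) by (intro sum.cong) (auto simp: pad_columns_def)
            also have "\<dots> = (\<beta> N * L2_set (V N \<omega>) ?J)\<^sup>2"
              by (simp add: L2_set_def power_mult_distrib sum_nonneg sum_distrib_left)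
            finally have "sqrt (2 * a') \<le> \<beta> N * L2_set (V N \<omega>) ?J"
              using \<beta> by (intro real_le_lsqrt) (auto simp: L2_set_nonneg)
            then show "r \<le> L2_set (V N \<omega>) ?J"
              using \<beta> by (simp add: r_def field_simps)
          qed
        qed
        also have "\<dots> = measure (\<mu> N) {v\<in>space (\<mu> N). r \<le> L2_set v ?J}"
          using elim Sm by (intro transfer[symmetric]) auto
        also have "\<dots> \<le> K * exp (- ((1 - \<kappa>) * a' * s N))"
          using elim(2)[rule_format, OF haar[OF elim(4)] r(1)] unfolding r(2) .
        also have "\<dots> = (K * exp (- d * s N)) * exp (- s N * a)"
          by (simp add: d_def algebra_simps flip: exp_add)
        also have "\<dots> \<le> 1 * exp (- s N * a)"
          using elim(1) by (intro mult_right_mono) auto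
        finally have "Q C N \<le> exp (- s N * a)" by simp
        from scaled_ext_ln_le[OF elim(3) this] show ?case by (simp add: Q_def)
      qed
      then show ?thesis by (rule Limsup_bounded)
    qed
    show ?thesis
    proof (rule ccontr)
      assume "\<not> ?thesis"
      then have "- enn2ereal (INF x\<in>C. ?I x) < ?L" by simp
      then obtain z where z: "- enn2ereal (INF x\<in>C. ?I x) < ereal z" "ereal z < ?L"
        using ereal_dense2 by blast
      have "ereal z < 0" using z(2) zero by (rule less_le_trans)
      then have z0: "0 \<le> - z" by (simp add: zero_ereal_def)
      have "ereal (- z) < enn2ereal (INF x\<in>C. ?I x)"
        using z(1) by (simp add: ereal_uminus_less_reorder)
      then have "ennreal (- z) < (INF x\<in>C. ?I x)"
        using z0 by (simp add: less_ennreal.rep_eq enn2ereal_ennreal)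
      from bound[OF z0 this] z(2) show False by simp
    qed
  qed
  have "satisfies_LDP M ?X s ?I"
    unfolding satisfies_LDP_def using prob speed rate_function_frobenius lower upper
    by (auto simp: Q_def)
  then show ?thesis
    using good_rate_function_frobenius convex_functional_frobenius by (simp add: s_def[abs_def])
qed

end
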